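(* Let $n\ge 1$ and let $(\sigma_t)_{t\ge 0}$ be the interchange process on the complete graph $K_n$ started from the identity. Fix any $1\le k\le n$ and $t\ge 0$, and let $s_k(t)$ be the number of cycles of size $k$ of the permutation $\sigma_t$. Then $$\mathbb{E}(s_k(t)) = \binom nk\left[\frac1k\, x\,\phi(x)+\int_x^1\phi(y)\,dy\right],$$ where $\phi(y)=y^{n-k}(1-y)^{k-1}$ and $x=e^{-tk}$.
   Context: The interchange process on $K_n$ is the continuous-time random walk $(\sigma_t)_{t\ge0}$ on the symmetric group $S_n$, with $\sigma_0=\mathrm{id}$, in which each of the $\binom n2$ transpositions $(i,j)$, $1\le i<j\le n$, is applied (multiplied to the current permutation) at rate $1$, independently. Equivalently, its generator, viewed as an element of the group algebra $\mathbb{C}[S_n]$, is $Q=\sum_{i<j}[(i,j)-\mathrm{id}]$, and $\mathbb{P}(\sigma_t=s)$ is the coefficient of $s$ in $e^{tQ}$. Fixed points count as cycles of size $1$. The convention $0^0=1$ is used. *)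

theory Defs
  imports "HOL-Probability.Probability" "HOL-Combinatorics.Combinatorics"
begin

abbreviation Sn :: "nat \<Rightarrow> (nat \<Rightarrow> nat) set" where
  "Sn n \<equiv> {p. p permutes {1..n}}"

text \<open>An element of the group algebra of \<open>Sn n\<close> over the complex numbers is represented by its
  coefficient function, which is \<open>0\<close> off \<open>Sn n\<close>. The product of basis elements \<open>p\<close> and \<open>q\<close>
  is \<open>p \<circ> q\<close>.\<close>

type_synonym group_alg = "(nat \<Rightarrow> nat) \<Rightarrow> complex"

definition ga_basis :: "(nat \<Rightarrow> nat) \<Rightarrow> group_alg" where
  "ga_basis p = (\<lambda>s. if s = p then 1 else 0)"

definition ga_mult :: "nat \<Rightarrow> group_alg \<Rightarrow> group_alg \<Rightarrow> group_alg" where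
  "ga_mult n a b =
     (\<lambda>s. \<Sum>(p, q) \<in> {(p, q). p \<in> Sn n \<and> q \<in> Sn n \<and> p \<circ> q = s}. a p * b q)"

primrec ga_power :: "nat \<Rightarrow> group_alg \<Rightarrow> nat \<Rightarrow> group_alg" where
  "ga_power n a 0 = ga_basis id"
| "ga_power n a (Suc m) = ga_mult n a (ga_power n a m)"

definition ga_exp :: "nat \<Rightarrow> group_alg \<Rightarrow> group_alg" where
  "ga_exp n a = (\<lambda>s. \<Sum>m. ga_power n a m s / fact m)"

definition interchange_gen :: "nat \<Rightarrow> group_alg" where
  "interchange_gen n =
     (\<lambda>s. \<Sum>(i, j) \<in> {(i, j). 1 \<le> i \<and> i < j \<and> j \<le> n}.
        ga_basis (Transposition.transpose i j) s - ga_basis id s)"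

text \<open>The continuous-time random walk on \<open>Sn n\<close> with generator \<open>interchange_gen n\<close>, on an
  arbitrary probability space: it starts at the identity, is a right-continuous jump process,
  and has independent stationary increments whose law over a time span \<open>h\<close> is given by the
  coefficients of the exponential of \<open>h\<close> times the generator. Increments are multiplied on the
  left; as the generator is central, multiplying on the right gives the same process in law.\<close>

locale interchange_process = prob_space M
  for M :: "'a measure" and n :: nat and \<sigma> :: "real \<Rightarrow> 'a \<Rightarrow> nat \<Rightarrow> nat" +
  assumes measurable_state:
      "\<And>t. 0 \<le> t \<Longrightarrow> random_variable (count_space (Sn n)) (\<sigma> t)"
    and start: "AE \<omega> in M. \<sigma> 0 \<omega> = id"
    and right_continuous:
      "AE \<omega> in M. \<forall>t\<ge>0. \<forall>\<^sub>F u in at_right t. \<sigma> u \<omega> = \<sigma> t \<omega>"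
    and indep_increments:
      "\<And>(u :: nat \<Rightarrow> real) m. mono u \<Longrightarrow> 0 \<le> u 0 \<Longrightarrow>
         indep_vars (\<lambda>_. count_space (Sn n))
           (\<lambda>i \<omega>. \<sigma> (u (Suc i)) \<omega> \<circ> inv (\<sigma> (u i) \<omega>)) {..<m}"
    and increment_law:
      "\<And>s t p. 0 \<le> s \<Longrightarrow> s \<le> t \<Longrightarrow> p \<in> Sn n \<Longrightarrow>
         complex_of_real (prob {\<omega> \<in> space M. \<sigma> t \<omega> \<circ> inv (\<sigma> s \<omega>) = p}) =
         ga_exp n (\<lambda>q. complex_of_real (t - s) * interchange_gen n q) p"

text \<open>The cycles of \<open>p\<close> correspond to its orbits on \<open>{1..n}\<close>; a fixed point has a singleton orbit.\<close>

definition num_cycles :: "nat \<Rightarrow> nat \<Rightarrow> (nat \<Rightarrow> nat) \<Rightarrow> nat" where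
  "num_cycles n k p = card {C \<in> orbit p ` {1..n}. card C = k}"

end

theory Submission
  imports Defs
begin

text \<open>Give a cycle of length \<open>m\<close> the weight \<open>1 + u^m - (u z)^m\<close> and let \<open>F(p)\<close> be the product of
  the weights of the cycles of \<open>p\<close>. A transposition splits one cycle or merges two, so the sum of
  \<open>F\<close> over all products of a transposition with \<open>p\<close> is a second-order differential operator in
  \<open>u\<close> and \<open>z\<close> applied to \<open>F(p)\<close>. After multiplication by \<open>(1 - u) / (1 - u z)\<close> this operator no
  longer mixes powers of \<open>u\<close>: the coefficient of \<open>u^k\<close> is \<open>(1 - z) \<rho>\<^sub>k(p)\<close> with a polynomial
  \<open>\<rho>\<^sub>k\<close> in \<open>z\<close>, and the generator acts on \<open>\<rho>\<^sub>k\<close> as \<open>-k (n + 1 - k + z d/dz)\<close>. Hence the coefficients of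
  \<open>\<rho>\<^sub>k\<close> are eigenfunctions, and running the process for time \<open>t\<close> replaces \<open>\<rho>\<^sub>k(z)\<close> by
  \<open>x^(n + 1 - k) \<rho>\<^sub>k(x z)\<close>, where \<open>x = exp (-t k)\<close>. At \<open>z = 1\<close> the polynomial \<open>\<rho>\<^sub>k(p)\<close> equals
  \<open>k\<close> times the number of \<open>k\<close>-cycles of \<open>p\<close>, minus \<open>1\<close>, while \<open>\<rho>\<^sub>k(id)\<close> is explicit; a
  binomial tail is turned into the integral.\<close>

unbundle no vec_syntax
unbundle fps_syntax

section \<open>Orbits under multiplication by a transposition\<close>

text \<open>Serves to read off an orbit from an explicit list of its points: following
  \<open>h\<close> closes up after \<open>d\<close> steps, so the list exhausts the orbit.\<close>

lemma orbit_of_cycle: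
  assumes "0 < d" and "\<And>e. Suc e < d \<Longrightarrow> q (h e) = h (Suc e)" and "q (h (d - 1)) = h 0"
  shows "orbit q (h 0) = h ` {..<d}"
proof -
  have pow: "(q ^^ e) (h 0) = h e" if "e < d" for e
    using that by (induction e) (simp_all add: assms(2))
  have "(q ^^ d) (h 0) = q ((q ^^ (d - 1)) (h 0))"
    using assms(1) by (metis Suc_pred' funpow.simps(2) comp_apply)
  then have "(q ^^ d) (h 0) = h 0"
    using pow[of "d - 1"] assms(1,3) by simp
  then have "orbit q (h 0) = {(q ^^ m) (h 0) | m. m < d}"
    using assms(1) by (rule orbit_altdef_bounded)
  then show ?thesis using pow by force
qed

context
  fixes p :: "'a \<Rightarrow> 'a" and S :: "'a set"
  assumes p: "p permutes S" and S: "finite S"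
begin

lemma permutes_self_in_orbit: "x \<in> orbit p x"
  using p S permutation_permutes permutation_self_in_orbit by metis

lemma permutes_orbit_eq: "y \<in> orbit p x \<Longrightarrow> orbit p y = orbit p x"
  using orbit_cyclic_eq3[OF cyclic_on_orbit[OF p S]] by blast

lemma permutes_orbit_disjoint:
  "orbit p x \<noteq> orbit p y \<Longrightarrow> orbit p x \<inter> orbit p y = {}"
  using permutes_orbit_eq by (metis disjoint_iff)

lemma permutes_finite_orbit: "finite (orbit p x)"
  using finite_orbit permutes_self_in_orbit by metis

lemma card_orbit_pos: "0 < card (orbit p x)"
  using permutes_finite_orbit permutes_self_in_orbit by (metis card_gt_0_iff empty_iff)

text \<open>The first return time \<open>funpow_dist1 p i i\<close> is the length of the cycle, so
  the exponents below \<open>card (orbit p i)\<close> serve as coordinates on it.\<close>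

lemma orbit_enumeration:
  shows "inj_on (\<lambda>e. (p ^^ e) i) {..<card (orbit p i)}"
    and "(\<lambda>e. (p ^^ e) i) ` {..<card (orbit p i)} = orbit p i"
    and "(p ^^ card (orbit p i)) i = i"
proof -
  let ?d = "funpow_dist1 p i i"
  have inj: "inj_on (\<lambda>e. (p ^^ e) i) {0..<?d}"
    by (rule inj_on_funpow_dist1[OF permutes_self_in_orbit])
  have im: "orbit p i = (\<lambda>e. (p ^^ e) i) ` {0..<?d}"
    by (rule orbit_conv_funpow_dist1[OF permutes_self_in_orbit])
  have c: "card (orbit p i) = ?d"
    using card_image[OF inj] im by simp
  show "inj_on (\<lambda>e. (p ^^ e) i) {..<card (orbit p i)}"
    and "(\<lambda>e. (p ^^ e) i) ` {..<card (orbit p i)} = orbit p i"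
    using inj im unfolding c by (simp_all add: lessThan_atLeast0)
  show "(p ^^ card (orbit p i)) i = i"
    unfolding c by (rule funpow_dist1_prop[OF permutes_self_in_orbit])
qed

lemma orbit_transpose_comp_away:
  assumes "i \<notin> orbit p x" "j \<notin> orbit p x"
  shows "orbit (Transposition.transpose i j \<circ> p) x = orbit p x"
proof -
  have "orbit p x = orbit (Transposition.transpose i j \<circ> p) x"
  proof (rule orbit_cong0[OF permutes_self_in_orbit])
    show "p \<in> orbit p x \<rightarrow> orbit p x" by (auto intro: orbit.step)
    show "p y = (Transposition.transpose i j \<circ> p) y" if "y \<in> orbit p x" for y
    proof -
      have "p y \<in> orbit p x" using that by (rule orbit.step)
      then show ?thesis using assms by (metis comp_apply Transposition.transpose_apply_other)
    qed
  qed
  then show ?thesis ..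
qed

lemma orbits_remove:
  assumes "i \<in> S"
  shows "orbit p ` S - {orbit p i} = orbit p ` (S - orbit p i)"
  using permutes_orbit_eq permutes_self_in_orbit by blast

text \<open>Multiplying by the transposition on the left redirects only the two arrows of
  \<open>p\<close> that end in \<open>i\<close> and \<open>j\<close>: the predecessor of
  \<open>j\<close> now leads to \<open>i\<close> and that of \<open>i\<close> to \<open>j\<close>.
  The cycle closes up early, after \<open>d\<close> steps, and the rest closes up on its
  own.\<close>

lemma orbit_split:
  assumes d: "0 < d" "d < card (orbit p i)"
  defines "j \<equiv> (p ^^ d) i"
  defines "q \<equiv> Transposition.transpose i j \<circ> p"
  shows "orbit q i = (\<lambda>e. (p ^^ e) i) ` {..<d}"
    and "orbit q j = (\<lambda>e. (p ^^ e) i) ` {d..<card (orbit p i)}"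
proof -
  let ?m = "card (orbit p i)"
  let ?h = "\<lambda>e. (p ^^ e) i"
  have inj: "inj_on ?h {..<?m}" by (rule orbit_enumeration)
  have ne: "?h a \<noteq> ?h b" if "a < ?m" "b < ?m" "a \<noteq> b" for a b
    using inj that by (auto dest: inj_onD)
  have step: "q (?h e) = ?h (Suc e)" if "Suc e < ?m" "Suc e \<noteq> d" for e
  proof -
    have "p (?h e) \<noteq> i" using ne[of "Suc e" 0] that by simp
    moreover have "p (?h e) \<noteq> j" using ne[of "Suc e" d] that d by (simp add: j_def)
    ultimately show ?thesis by (simp add: q_def)
  qed
  have "orbit q (?h 0) = ?h ` {..<d}"
  proof (rule orbit_of_cycle)
    have "p (?h (d - 1)) = j" using d by (metis Suc_pred' funpow.simps(2) comp_apply j_def)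
    then show "q (?h (d - 1)) = ?h 0" by (simp add: q_def)
  qed (use d step in auto)
  then show "orbit q i = ?h ` {..<d}" by simp
  have "orbit q ((\<lambda>e. ?h (d + e)) 0) = (\<lambda>e. ?h (d + e)) ` {..<?m - d}"
  proof (rule orbit_of_cycle)
    have "p (?h (?m - 1)) = ?h ?m" using d by (metis Suc_pred' funpow.simps(2) comp_apply gr_implies_not0 gr0I)
    then have "p (?h (?m - 1)) = i" using orbit_enumeration(3) by simp
    then show "q (?h (d + (?m - d - 1))) = ?h (d + 0)" using d by (simp add: q_def j_def)
    show "q (?h (d + e)) = ?h (d + Suc e)" if "Suc e < ?m - d" for e
      using step[of "d + e"] that by simp
  qed (use d in auto)
  also have "\<dots> = ?h ` ((+) d ` {..<?m - d})" by (simp add: image_image)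
  also have "(+) d ` {..<?m - d} = {d..<?m}" using d by (simp add: lessThan_atLeast0)
  finally show "orbit q j = ?h ` {d..<?m}" by (simp add: j_def)
qed

text \<open>The same two arrows are redirected, but now they lie on different cycles, so each cycle
  continues into the other instead of closing up.\<close>

lemma orbit_merge:
  assumes ij: "orbit p i \<noteq> orbit p j"
  shows "orbit (Transposition.transpose i j \<circ> p) i = orbit p i \<union> orbit p j"
proof -
  let ?q = "Transposition.transpose i j \<circ> p" and ?m = "card (orbit p i)" and ?m' = "card (orbit p j)"
  \<comment> \<open>One turn of the cycle of \<open>i\<close> followed by one turn of the cycle of
    \<open>j\<close>.\<close>
  define h where "h e = (if e < ?m then (p ^^ e) i else (p ^^ (e - ?m)) j)" for e
  note en = orbit_enumeration
  have pos: "0 < ?m" "0 < ?m'" by (rule card_orbit_pos)+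
  have disj: "orbit p i \<inter> orbit p j = {}" by (rule permutes_orbit_disjoint[OF ij])
  have ini: "(p ^^ e) i \<in> orbit p i" and inj: "(p ^^ e) j \<in> orbit p j" for e
    using funpow_in_orbit permutes_self_in_orbit by metis+
  have ne: "(p ^^ e) i \<noteq> j" "(p ^^ e) j \<noteq> i" for e
    using ini inj disj permutes_self_in_orbit by (metis disjoint_iff)+
  have nei: "(p ^^ e) i \<noteq> i" if "e < ?m" "0 < e" for e
    using inj_onD[OF en(1)[of i], of e 0] that by auto
  have nej: "(p ^^ e) j \<noteq> j" if "e < ?m'" "0 < e" for e
    using inj_onD[OF en(1)[of j], of e 0] that by auto
  have "orbit ?q (h 0) = h ` {..<?m + ?m'}"
  proof (rule orbit_of_cycle)
    show "?q (h e) = h (Suc e)" if "Suc e < ?m + ?m'" for e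
    proof -
      consider "Suc e < ?m" | "Suc e = ?m" | "?m \<le> e" by linarith
      then show ?thesis
      proof cases
        case 1
        then have "p ((p ^^ e) i) \<noteq> i" "p ((p ^^ e) i) \<noteq> j"
          using nei[of "Suc e"] ne(1)[of "Suc e"] by auto
        then show ?thesis using 1 by (simp add: h_def)
      next
        case 2
        then have "p ((p ^^ e) i) = i" using en(3)[of i] by (metis funpow.simps(2) comp_apply)
        then show ?thesis using 2 by (simp add: h_def)
      next
        case 3
        have "p ((p ^^ (e - ?m)) j) \<noteq> i" "p ((p ^^ (e - ?m)) j) \<noteq> j"
          using nej[of "Suc (e - ?m)"] ne(2)[of "Suc (e - ?m)"] that 3 by auto
        then show ?thesis using 3 by (simp add: h_def Suc_diff_le)
      qed
    qed
    have "p ((p ^^ (?m' - 1)) j) = j"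
      using en(3)[of j] pos(2) by (metis Suc_pred' funpow.simps(2) comp_apply)
    moreover have "\<not> ?m + ?m' - 1 < ?m" "?m + ?m' - 1 - ?m = ?m' - 1" using pos by auto
    ultimately show "?q (h (?m + ?m' - 1)) = h 0"
      using pos by (simp add: h_def)
  qed (use pos in simp)
  moreover have "h ` {..<?m + ?m'} = h ` {..<?m} \<union> h ` ((+) ?m ` {..<?m'})"
  proof -
    have "{..<?m + ?m'} = {..<?m} \<union> {?m..<?m + ?m'}" by auto
    moreover have "(+) ?m ` {..<?m'} = {?m..<?m + ?m'}" by (simp add: lessThan_atLeast0 add.commute)
    ultimately show ?thesis by (simp add: image_Un)
  qed
  moreover have "h ` {..<?m} = orbit p i"
    using en(2)[of i] by (simp add: h_def cong: image_cong_simp)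
  moreover have "h ` ((+) ?m ` {..<?m'}) = orbit p j"
  proof -
    have "h ` ((+) ?m ` {..<?m'}) = (\<lambda>e. h (?m + e)) ` {..<?m'}" by (rule image_image)
    also have "\<dots> = (\<lambda>e. (p ^^ e) j) ` {..<?m'}" by (simp add: h_def)
    finally show ?thesis using en(2)[of j] by simp
  qed
  ultimately show ?thesis using pos by (simp add: h_def)
qed

end

section \<open>Products of cycle weights after one transposition\<close>

lemma permutes_transpose_comp:
  assumes "p permutes S" "i \<in> S" "j \<in> S"
  shows "Transposition.transpose i j \<circ> p permutes S"
  using assms by (intro permutes_compose permutes_swap_id)

text \<open>Only the cycle of \<open>i\<close> is affected; every other cycle keeps its
  factor.\<close>

lemma prod_orbits_split:
  fixes g :: "nat \<Rightarrow> 'b :: comm_monoid_mult"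
  assumes p: "p permutes S" and S: "finite S" and i: "i \<in> S"
    and d: "0 < d" "d < card (orbit p i)"
  shows "(\<Prod>D \<in> orbit (Transposition.transpose i ((p ^^ d) i) \<circ> p) ` S. g (card D)) =
    g d * g (card (orbit p i) - d) * (\<Prod>D \<in> orbit p ` S - {orbit p i}. g (card D))"
proof -
  let ?m = "card (orbit p i)" and ?j = "(p ^^ d) i" and ?C = "orbit p i"
  let ?h = "\<lambda>e. (p ^^ e) i"
  let ?q = "Transposition.transpose i ?j \<circ> p"
  have CS: "?C \<subseteq> S" by (rule permutes_orbit_subset[OF p i])
  have jC: "?j \<in> ?C" using funpow_in_orbit permutes_self_in_orbit[OF p S] by metis
  have q: "?q permutes S" using p i jC CS by (intro permutes_transpose_comp) auto
  have inj: "inj_on ?h {..<?m}" and im: "?h ` {..<?m} = ?C"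
    using orbit_enumeration[OF p S] by auto
  have 1: "orbit ?q i = ?h ` {..<d}" and 2: "orbit ?q ?j = ?h ` {d..<?m}"
    using orbit_split[OF p S d] by auto
  have "{..<d} \<union> {d..<?m} = {..<?m}" using d by auto
  then have un: "orbit ?q i \<union> orbit ?q ?j = ?C"
    using 1 2 im by (metis image_Un)
  have sub: "{..<d} \<subseteq> {..<?m}" "{d..<?m} \<subseteq> {..<?m}" using d by auto
  have c1: "card (orbit ?q i) = d"
    unfolding 1 using inj_on_subset[OF inj sub(1)] by (simp add: card_image)
  have c2: "card (orbit ?q ?j) = ?m - d"
    unfolding 2 using inj_on_subset[OF inj sub(2)] by (simp add: card_image)
  have disj: "orbit ?q i \<inter> orbit ?q ?j = {}"
    unfolding 1 2 using inj_on_image_Int[OF inj sub] by (auto simp: disjoint_iff)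
  have away: "orbit ?q x = orbit p x" if "x \<in> S - ?C" for x
  proof -
    have "orbit p x \<inter> ?C = {}"
      using that permutes_orbit_disjoint[OF p S] permutes_self_in_orbit[OF p S] by (metis DiffD2)
    then show ?thesis
      using orbit_transpose_comp_away[OF p S] jC permutes_self_in_orbit[OF p S] by (metis disjoint_iff)
  qed
  have "orbit ?q ` S = orbit ?q ` (S - ?C) \<union> orbit ?q ` ?C" using CS by blast
  also have "orbit ?q ` (S - ?C) = orbit p ` (S - ?C)" using away by (rule image_cong[OF refl])
  also have "\<dots> = orbit p ` S - {?C}" using orbits_remove[OF p S i] by simp
  also have "orbit ?q ` ?C = {orbit ?q i, orbit ?q ?j}"
  proof
    show "orbit ?q ` ?C \<subseteq> {orbit ?q i, orbit ?q ?j}"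
      using un permutes_orbit_eq[OF q S] by blast
    show "{orbit ?q i, orbit ?q ?j} \<subseteq> orbit ?q ` ?C"
      using jC permutes_self_in_orbit[OF p S] by auto
  qed
  finally have O: "orbit ?q ` S = (orbit p ` S - {?C}) \<union> {orbit ?q i, orbit ?q ?j}" .
  \<comment> \<open>The product runs over a set of orbits, so the two new orbits must differ from
    each other and from all surviving ones for no factor to be lost.\<close>
  have notin: "D \<notin> orbit p ` S - {?C}" if "D \<subseteq> ?C" "D \<noteq> {}" for D
    using that permutes_orbit_disjoint[OF p S] by fastforce
  have ne: "orbit ?q i \<noteq> {}" "orbit ?q ?j \<noteq> {}" using permutes_self_in_orbit[OF q S] by auto
  then have neq: "orbit ?q i \<noteq> orbit ?q ?j" using disj by auto
  have "orbit ?q i \<notin> orbit p ` S - {?C}" "orbit ?q ?j \<notin> orbit p ` S - {?C}"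
    using notin un ne by blast+
  then show ?thesis unfolding O using S neq c1 c2
    by (simp add: mult_ac)
qed

lemma prod_orbits_merge:
  fixes g :: "nat \<Rightarrow> 'b :: comm_monoid_mult"
  assumes p: "p permutes S" and S: "finite S" and i: "i \<in> S" and j: "j \<in> S"
    and ij: "orbit p i \<noteq> orbit p j"
  shows "(\<Prod>D \<in> orbit (Transposition.transpose i j \<circ> p) ` S. g (card D)) =
    g (card (orbit p i) + card (orbit p j)) *
      (\<Prod>D \<in> orbit p ` S - {orbit p i} - {orbit p j}. g (card D))"
proof -
  let ?C = "orbit p i" and ?D = "orbit p j" and ?q = "Transposition.transpose i j \<circ> p"
  have CS: "?C \<subseteq> S" "?D \<subseteq> S" using permutes_orbit_subset[OF p] i j by auto
  have q: "?q permutes S" using p i j by (rule permutes_transpose_comp)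
  have disj: "?C \<inter> ?D = {}" by (rule permutes_orbit_disjoint[OF p S ij])
  note self = permutes_self_in_orbit[OF p S]
  have un: "orbit ?q i = ?C \<union> ?D" by (rule orbit_merge[OF p S ij])
  have away: "orbit ?q x = orbit p x" if "x \<in> S - ?C - ?D" for x
  proof -
    have "orbit p x \<inter> ?C = {}" "orbit p x \<inter> ?D = {}"
      using that permutes_orbit_disjoint[OF p S] self by (metis DiffD1 DiffD2)+
    then show ?thesis
      using orbit_transpose_comp_away[OF p S] self by (metis disjoint_iff)
  qed
  have "orbit ?q ` S = orbit ?q ` (S - ?C - ?D) \<union> orbit ?q ` (?C \<union> ?D)" using CS by blast
  also have "orbit ?q ` (S - ?C - ?D) = orbit p ` (S - ?C - ?D)" using away by (rule image_cong[OF refl])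
  also have "\<dots> = orbit p ` S - {?C} - {?D}"
    using permutes_orbit_eq[OF p S] self by blast
  also have "orbit ?q ` (?C \<union> ?D) = {?C \<union> ?D}"
    using un permutes_orbit_eq[OF q S] self by blast
  finally have O: "orbit ?q ` S = (orbit p ` S - {?C} - {?D}) \<union> {?C \<union> ?D}" .
  have "?C \<union> ?D \<notin> orbit p ` S - {?C} - {?D}"
  proof
    assume "?C \<union> ?D \<in> orbit p ` S - {?C} - {?D}"
    then obtain x where x: "?C \<union> ?D = orbit p x" "orbit p x \<noteq> ?C" by auto
    then show False using permutes_orbit_disjoint[OF p S x(2)] self[of i] by blast
  qed
  moreover have "card (?C \<union> ?D) = card ?C + card ?D"
    using disj permutes_finite_orbit[OF p S] by (intro card_Un_disjoint)
  ultimately show ?thesis unfolding O using S by simp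
qed

section \<open>Sums of cycle weights over all transpositions\<close>

lemma sum_over_orbits:
  fixes f :: "'a \<Rightarrow> 'b :: comm_monoid_add"
  assumes p: "p permutes S" and S: "finite S"
  shows "(\<Sum>x\<in>S. f x) = (\<Sum>C\<in>orbit p ` S. \<Sum>x\<in>C. f x)"
proof -
  have "{x \<in> S. orbit p x = C} = C" if "C \<in> orbit p ` S" for C
    using that permutes_self_in_orbit[OF p S] permutes_orbit_eq[OF p S] permutes_orbit_subset[OF p]
    by blast
  then show ?thesis
    by (subst sum.image_gen[OF S, of _ "orbit p"]) simp
qed

lemma sum_card_orbits:
  assumes "p permutes S" and "finite S"
  shows "(\<Sum>C\<in>orbit p ` S. card C) = card S"
  using sum_over_orbits[OF assms, of "\<lambda>_. 1::nat"] by simp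

abbreviation pairs :: "nat \<Rightarrow> (nat \<times> nat) set" where
  "pairs n \<equiv> {(i, j). 1 \<le> i \<and> i < j \<and> j \<le> n}"

text \<open>Ordered pairs count every transposition twice, but they are easier to group by the cycle
  of the first entry. The factor stays on the left because a semiring has no division.\<close>

lemma double_sum_pairs:
  fixes h :: "nat \<Rightarrow> nat \<Rightarrow> 'b :: comm_semiring_1"
  assumes sym: "\<And>i j. h i j = h j i"
  shows "2 * (\<Sum>(i, j)\<in>pairs n. h i j) =
    (\<Sum>i\<in>{1..n}. \<Sum>j\<in>{1..n} - {i}. h i j)"
proof -
  let ?I = "{(i, j). 1 \<le> i \<and> i < j \<and> j \<le> n}" and ?J = "{(i, j). 1 \<le> j \<and> j < i \<and> i \<le> n}"
  have fin: "finite ?I" "finite ?J"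
    by (rule finite_subset[of _ "{1..n} \<times> {1..n}"]; auto)+
  have "(\<Sum>(i, j)\<in>?J. h i j) = (\<Sum>(i, j)\<in>?I. h i j)"
    by (rule sum.reindex_bij_witness[of _ prod.swap prod.swap]) (auto simp: sym)
  moreover have "(\<Sum>i\<in>{1..n}. \<Sum>j\<in>{1..n} - {i}. h i j) = (\<Sum>(i, j)\<in>?I \<union> ?J. h i j)"
    by (subst sum.Sigma) (auto intro!: sum.cong)
  moreover have "(\<Sum>(i, j)\<in>?I \<union> ?J. h i j) = (\<Sum>(i, j)\<in>?I. h i j) + (\<Sum>(i, j)\<in>?J. h i j)"
    by (rule sum.union_disjoint) (use fin in auto)
  ultimately show ?thesis by (simp add: mult_2)
qed

definition cycle_prod :: "(nat \<Rightarrow> 'b :: comm_monoid_mult) \<Rightarrow> nat \<Rightarrow> (nat \<Rightarrow> nat) \<Rightarrow> 'b" where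
  "cycle_prod g n p = (\<Prod>C \<in> orbit p ` {1..n}. g (card C))"

text \<open>For fixed \<open>i\<close>, a point \<open>j = (p ^^ d) i\<close> of the same cycle
  \<open>C\<close> cuts it into lengths \<open>d\<close> and \<open>card C - d\<close>; a point of
  another cycle \<open>D\<close> joins the two, with the same result for each of the
  \<open>card D\<close> choices. The outcome depends on \<open>i\<close> only through its cycle,
  whence the factor \<open>card C\<close>.\<close>

lemma sum_transpositions_cycle_prod:
  fixes g :: "nat \<Rightarrow> 'b :: comm_semiring_1"
  assumes p: "p permutes {1..n}"
  defines "Os \<equiv> orbit p ` {1..n}"
  shows "2 * (\<Sum>(i, j)\<in>pairs n.
      cycle_prod g n (Transposition.transpose i j \<circ> p)) =
    (\<Sum>C\<in>Os. of_nat (card C) * (\<Sum>d\<in>{1..<card C}. g d * g (card C - d)) * (\<Prod>E\<in>Os - {C}. g (card E))) +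
    (\<Sum>C\<in>Os. \<Sum>D\<in>Os - {C}. of_nat (card C) * of_nat (card D) * g (card C + card D) *
       (\<Prod>E\<in>Os - {C} - {D}. g (card E)))"
proof -
  let ?S = "{1..n}"
  let ?h = "\<lambda>i j. cycle_prod g n (Transposition.transpose i j \<circ> p)"
  have S: "finite ?S" by simp
  note self = permutes_self_in_orbit[OF p S]
  have sub: "orbit p i \<subseteq> ?S" if "i \<in> ?S" for i
    by (rule permutes_orbit_subset[OF p that])
  have fin: "finite Os" by (simp add: Os_def)
  have split: "(\<Sum>j\<in>orbit p i - {i}. ?h i j) =
      (\<Sum>d\<in>{1..<card (orbit p i)}. g d * g (card (orbit p i) - d)) * (\<Prod>E\<in>Os - {orbit p i}. g (card E))"
    if i: "i \<in> ?S" for i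
  proof -
    let ?m = "card (orbit p i)"
    have inj: "inj_on (\<lambda>e. (p ^^ e) i) {..<?m}" and im: "(\<lambda>e. (p ^^ e) i) ` {..<?m} = orbit p i"
      using orbit_enumeration[OF p S] by auto
    have "{1..<?m} = {..<?m} - {0}" by auto
    moreover have "(\<lambda>e. (p ^^ e) i) ` ({..<?m} - {0}) = orbit p i - {i}"
      using inj_on_image_set_diff[OF inj, of "{..<?m}" "{0}"] im card_orbit_pos[OF p S, of i] by auto
    ultimately have "(\<Sum>j\<in>orbit p i - {i}. ?h i j) = (\<Sum>d\<in>{1..<?m}. ?h i ((p ^^ d) i))"
      using inj_on_subset[OF inj, of "{..<?m} - {0}"]
      by (subst sum.reindex_cong[of "\<lambda>e. (p ^^ e) i" "{..<?m} - {0}"]) auto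
    also have "\<dots> = (\<Sum>d\<in>{1..<?m}. g d * g (?m - d) * (\<Prod>E\<in>Os - {orbit p i}. g (card E)))"
      unfolding cycle_prod_def Os_def by (intro sum.cong refl prod_orbits_split[OF p S i]) auto
    finally show ?thesis by (simp add: sum_distrib_right)
  qed
  have merge: "(\<Sum>j\<in>?S - orbit p i. ?h i j) =
      (\<Sum>D\<in>Os - {orbit p i}. of_nat (card D) * (g (card (orbit p i) + card D) *
         (\<Prod>E\<in>Os - {orbit p i} - {D}. g (card E))))"
    if i: "i \<in> ?S" for i
  proof -
    let ?C = "orbit p i"
    \<comment> \<open>Extended by zero on the cycle of \<open>i\<close>, so that a sum over all of
      \<open>?S\<close> can be grouped by orbits.\<close>
    let ?k = "\<lambda>j. if j \<in> ?C then 0 else ?h i j"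
    have "(\<Sum>j\<in>?S - ?C. ?h i j) = (\<Sum>j\<in>?S. ?k j)"
      by (rule sum.mono_neutral_cong_left) auto
    also have "\<dots> = (\<Sum>D\<in>Os. \<Sum>j\<in>D. ?k j)"
      unfolding Os_def by (rule sum_over_orbits[OF p S])
    also have "\<dots> = (\<Sum>D\<in>Os - {?C}. \<Sum>j\<in>D. ?k j)"
      using fin by (intro sum.mono_neutral_right) auto
    also have "\<dots> = (\<Sum>D\<in>Os - {?C}. of_nat (card D) * (g (card ?C + card D) *
         (\<Prod>E\<in>Os - {?C} - {D}. g (card E))))"
    proof (rule sum.cong[OF refl])
      fix D assume D: "D \<in> Os - {?C}"
      have "?k j = g (card ?C + card D) * (\<Prod>E\<in>Os - {?C} - {D}. g (card E))" if j: "j \<in> D" for j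
      proof -
        have oD: "orbit p j = D" and jS: "j \<in> ?S"
          using D j permutes_orbit_eq[OF p S] sub unfolding Os_def by blast+
        then have ne: "?C \<noteq> orbit p j" using D by auto
        then have "j \<notin> ?C" using permutes_orbit_eq[OF p S] by metis
        then show ?thesis
          using prod_orbits_merge[OF p S i jS ne, of g] oD by (simp add: cycle_prod_def Os_def)
      qed
      then show "(\<Sum>j\<in>D. ?k j) = of_nat (card D) * (g (card ?C + card D) *
         (\<Prod>E\<in>Os - {?C} - {D}. g (card E)))"
        by simp
    qed
    finally show ?thesis .
  qed
  define A where "A C = (\<Sum>d\<in>{1..<card C}. g d * g (card C - d)) * (\<Prod>E\<in>Os - {C}. g (card E))" for C
  define B where "B C = (\<Sum>D\<in>Os - {C}. of_nat (card D) * (g (card C + card D) *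
         (\<Prod>E\<in>Os - {C} - {D}. g (card E))))" for C
  have "2 * (\<Sum>(i, j)\<in>pairs n. ?h i j) = (\<Sum>i\<in>?S. \<Sum>j\<in>?S - {i}. ?h i j)"
    by (rule double_sum_pairs) (simp add: transpose_commute)
  also have "\<dots> = (\<Sum>i\<in>?S. A (orbit p i) + B (orbit p i))"
  proof (rule sum.cong[OF refl])
    fix i assume i: "i \<in> ?S"
    have "?S - {i} = (orbit p i - {i}) \<union> (?S - orbit p i)" using sub[OF i] self[of i] by auto
    moreover have "finite (orbit p i)" by (rule permutes_finite_orbit[OF p S])
    ultimately have "(\<Sum>j\<in>?S - {i}. ?h i j) = (\<Sum>j\<in>orbit p i - {i}. ?h i j) + (\<Sum>j\<in>?S - orbit p i. ?h i j)"
      by (simp only:) (rule sum.union_disjoint; auto)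
    then show "(\<Sum>j\<in>?S - {i}. ?h i j) = A (orbit p i) + B (orbit p i)"
      using split[OF i] merge[OF i] by (simp add: A_def B_def)
  qed
  also have "\<dots> = (\<Sum>C\<in>Os. \<Sum>i\<in>C. A (orbit p i) + B (orbit p i))"
    unfolding Os_def by (rule sum_over_orbits[OF p S])
  also have "\<dots> = (\<Sum>C\<in>Os. of_nat (card C) * (A C + B C))"
  proof (rule sum.cong[OF refl])
    fix C assume "C \<in> Os"
    then have "orbit p i = C" if "i \<in> C" for i using that permutes_orbit_eq[OF p S] by (auto simp: Os_def)
    then show "(\<Sum>i\<in>C. A (orbit p i) + B (orbit p i)) = of_nat (card C) * (A C + B C)" by simp
  qed
  also have "\<dots> = (\<Sum>C\<in>Os. of_nat (card C) * A C) + (\<Sum>C\<in>Os. of_nat (card C) * B C)"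
    by (simp only: distrib_left sum.distrib)
  also have "(\<Sum>C\<in>Os. of_nat (card C) * B C) = (\<Sum>C\<in>Os. \<Sum>D\<in>Os - {C}. of_nat (card C) * of_nat (card D) *
      g (card C + card D) * (\<Prod>E\<in>Os - {C} - {D}. g (card E)))"
    by (simp only: B_def sum_distrib_left mult.assoc)
  finally show ?thesis by (simp only: A_def mult.assoc)
qed

section \<open>The cut-and-join equation\<close>

definition derivation :: "('r :: comm_ring_1 \<Rightarrow> 'r) \<Rightarrow> bool" where
  "derivation d \<longleftrightarrow> (\<forall>x y. d (x + y) = d x + d y) \<and> (\<forall>x y. d (x * y) = d x * y + x * d y)"

context
  fixes d :: "'r :: comm_ring_1 \<Rightarrow> 'r"
  assumes d: "derivation d"
begin

lemma derivation_add: "d (x + y) = d x + d y"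
  and derivation_mult: "d (x * y) = d x * y + x * d y"
  using d by (auto simp: derivation_def)

lemma derivation_0: "d 0 = 0"
  using derivation_add[of 0 0] by simp

lemma derivation_1: "d 1 = 0"
  using derivation_mult[of 1 1] by simp

lemma derivation_minus: "d (- x) = - d x"
  using derivation_add[of x "- x"] derivation_0 by (simp add: eq_neg_iff_add_eq_0 add.commute)

lemma derivation_diff: "d (x - y) = d x - d y"
  using derivation_add[of x "- y"] derivation_minus by simp

lemma derivation_sum: "d (sum f A) = (\<Sum>x\<in>A. d (f x))"
  by (induction A rule: infinite_finite_induct) (simp_all add: derivation_0 derivation_add)

lemma derivation_of_nat: "d (of_nat m) = 0"
  by (induction m) (simp_all add: derivation_0 derivation_1 derivation_add)

lemma derivation_eigen_power:
  assumes "d x = of_nat a * x"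
  shows "d (x ^ m) = of_nat (a * m) * x ^ m"
  by (induction m) (simp_all add: derivation_1 derivation_mult assms algebra_simps)

lemma derivation_prod:
  assumes "finite A"
  shows "d (\<Prod>x\<in>A. f x) = (\<Sum>x\<in>A. d (f x) * (\<Prod>y\<in>A - {x}. f y))"
  using assms
proof (induction A)
  case (insert a A)
  have "(\<Prod>y\<in>insert a A - {x}. f y) = f a * (\<Prod>y\<in>A - {x}. f y)" if "x \<in> A" for x
  proof -
    have "insert a A - {x} = insert a (A - {x})" using insert.hyps that by auto
    then show ?thesis using insert.hyps by simp
  qed
  then have "(\<Sum>x\<in>A. d (f x) * (\<Prod>y\<in>insert a A - {x}. f y)) = f a * (\<Sum>x\<in>A. d (f x) * (\<Prod>y\<in>A - {x}. f y))"
    by (simp add: sum_distrib_left mult_ac)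
  then show ?case using insert by (simp add: derivation_mult)
qed (simp add: derivation_1)

end

text \<open>The single sum differentiates one factor, the double sum two different ones; they are
  the counterparts of the cut terms and the join terms of
  \<open>sum_transpositions_cycle_prod\<close>.\<close>

lemma derivation2_prod:
  fixes d e :: "'r :: comm_ring_1 \<Rightarrow> 'r"
  assumes d: "derivation d" and e: "derivation e" and A: "finite A"
  shows "e (d (\<Prod>x\<in>A. f x)) = (\<Sum>x\<in>A. e (d (f x)) * (\<Prod>y\<in>A - {x}. f y)) +
    (\<Sum>x\<in>A. \<Sum>y\<in>A - {x}. d (f x) * e (f y) * (\<Prod>w\<in>A - {x} - {y}. f w))"
  using A by (simp add: derivation_prod[OF d] derivation_sum[OF e] derivation_mult[OF e]
      derivation_prod[OF e] sum.distrib sum_distrib_left mult.assoc)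

text \<open>Adding the double sum to itself with \<open>x\<close> and \<open>y\<close> exchanged
  makes it vanish termwise, and in characteristic zero the factor 2 can be cancelled.\<close>

lemma sum_off_diagonal_antisym:
  fixes h :: "'a \<Rightarrow> 'a \<Rightarrow> 'r :: {idom, semiring_char_0}"
  assumes A: "finite A"
    and h: "\<And>x y. x \<in> A \<Longrightarrow> y \<in> A \<Longrightarrow> h x y + h y x = 0"
    and P: "\<And>x y. P x y = P y x"
  shows "(\<Sum>x\<in>A. \<Sum>y\<in>A - {x}. h x y * P x y) = 0"
proof -
  let ?s = "\<lambda>x y. if x = y then 0 else h x y * P x y"
  have *: "(\<Sum>x\<in>A. \<Sum>y\<in>A - {x}. h x y * P x y) = (\<Sum>x\<in>A. \<Sum>y\<in>A. ?s x y)"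
    using A by (intro sum.cong refl sum.mono_neutral_cong_left) auto
  have "(\<Sum>x\<in>A. \<Sum>y\<in>A. ?s x y) + (\<Sum>x\<in>A. \<Sum>y\<in>A. ?s x y) =
      (\<Sum>x\<in>A. \<Sum>y\<in>A. ?s x y) + (\<Sum>x\<in>A. \<Sum>y\<in>A. ?s y x)"
    by (subst (3) sum.swap) simp
  also have "\<dots> = (\<Sum>x\<in>A. \<Sum>y\<in>A. ?s x y + ?s y x)" by (simp add: sum.distrib)
  also have "\<dots> = 0"
  proof (intro sum.neutral ballI)
    fix x y assume "x \<in> A" "y \<in> A"
    then have "h x y * P x y + h y x * P y x = 0"
      using h P[of x y] by (metis distrib_right mult_zero_left)
    then show "?s x y + ?s y x = 0" by simp
  qed
  finally have "2 * (\<Sum>x\<in>A. \<Sum>y\<in>A. ?s x y) = 0" by (simp only: mult_2)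
  then show ?thesis unfolding * by simp
qed

lemma one_minus_mult_geometric_sum:
  fixes x :: "'r :: comm_ring_1"
  assumes "1 \<le> m"
  shows "(1 - x) * (\<Sum>d\<in>{1..<m}. x ^ d) = x - x ^ m"
  using assms
proof (induction m rule: dec_induct)
  case (step n)
  then have "(\<Sum>d\<in>{1..<Suc n}. x ^ d) = (\<Sum>d\<in>{1..<n}. x ^ d) + x ^ n" by simp
  then show ?case using step by (simp add: distrib_left) (simp add: algebra_simps)
qed simp

text \<open>\<open>D1 = u d/du\<close> and \<open>D2 = z d/dz\<close>, abstractly.\<close>

locale euler_pair =
  fixes D1 D2 :: "'r :: {idom, semiring_char_0} \<Rightarrow> 'r" and U Z :: 'r
  assumes d1: "derivation D1" and d2: "derivation D2"
    and D1_U: "D1 U = U" and D2_U: "D2 U = 0" and D1_Z: "D1 Z = 0" and D2_Z: "D2 Z = Z"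
begin

definition V :: 'r where
  "V = U * Z"

lemma D_V: "D1 V = V" "D2 V = V"
  by (simp_all add: V_def D1_U D2_U D1_Z D2_Z derivation_mult[OF d1] derivation_mult[OF d2])

definition wt :: "nat \<Rightarrow> 'r" where
  "wt m = 1 + U ^ m - V ^ m"

lemma D_powers:
  "D1 (U ^ m) = of_nat m * U ^ m" "D1 (V ^ m) = of_nat m * V ^ m"
  "D2 (U ^ m) = 0" "D2 (V ^ m) = of_nat m * V ^ m"
  using derivation_eigen_power[OF d1, of U 1 m] derivation_eigen_power[OF d1, of V 1 m]
    derivation_eigen_power[OF d2, of U 0 m] derivation_eigen_power[OF d2, of V 1 m]
  by (simp_all add: D1_U D2_U D_V)

lemma D_wt:
  "D1 (wt m) = of_nat m * (U ^ m - V ^ m)" "D2 (wt m) = - of_nat m * V ^ m"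
  unfolding wt_def
  by (simp_all add: derivation_add[OF d1] derivation_add[OF d2] derivation_diff[OF d1]
      derivation_diff[OF d2] derivation_1[OF d1] derivation_1[OF d2] D_powers algebra_simps)

lemma D_D_wt:
  "D1 (D1 (wt m)) = of_nat m * of_nat m * (U ^ m - V ^ m)" "D1 (D2 (wt m)) = - of_nat m * of_nat m * V ^ m"
  unfolding D_wt
  by (simp_all add: derivation_diff[OF d1] derivation_mult[OF d1] derivation_of_nat[OF d1]
      derivation_minus[OF d1] D_powers algebra_simps)

text \<open>Each product \<open>wt d * wt (m - d)\<close> is a part free of \<open>d\<close> plus
  multiples of powers of \<open>U\<close>, \<open>V\<close> and \<open>Z\<close> with exponent
  \<open>d\<close> or \<open>m - d\<close>. Summation gives three geometric sums, whose denominators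
  are multiplied out.\<close>

lemma split_sum_wt:
  assumes m: "1 \<le> m"
  shows "(1 - U) * (1 - V) * (1 - Z) * (\<Sum>d\<in>{1..<m}. wt d * wt (m - d)) =
    (1 - U) * (1 - V) * (1 - Z) * ((of_nat m - 1) * (1 + U ^ m + V ^ m))
    + 2 * (1 - V) * (1 - Z) * (U - U ^ m) - 2 * (1 - U) * (1 - Z) * (V - V ^ m)
    - 2 * (1 - U) * (1 - V) * (U ^ m * Z - V ^ m)"
proof -
  \<comment> \<open>Reversal identifies the sums with exponent \<open>m - d\<close> with those with
    exponent \<open>d\<close>, hence the factors 2 below.\<close>
  have rev: "(\<Sum>d\<in>{Suc 0..<m}. f (m - d)) = (\<Sum>d\<in>{Suc 0..<m}. f d)" for f :: "nat \<Rightarrow> 'r"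
    by (rule sum.reindex_bij_witness[of _ "\<lambda>d. m - d" "\<lambda>d. m - d"]) auto
  have "wt d * wt (m - d) = (1 + U ^ m + V ^ m) + U ^ d + U ^ (m - d) - V ^ d - V ^ (m - d)
     - U ^ m * Z ^ (m - d) - U ^ m * Z ^ d" if "d \<in> {1..<m}" for d
  proof -
    have "U ^ m = U ^ d * U ^ (m - d)" "Z ^ m = Z ^ d * Z ^ (m - d)"
      using that by (simp_all flip: power_add)
    moreover have "(1 + A - A * P) * (1 + B - B * Q) = 1 + A * B + A * B * (P * Q) + A + B - A * P - B * Q
      - A * B * Q - A * B * P" for A B P Q :: 'r by algebra
    ultimately show ?thesis unfolding wt_def V_def power_mult_distrib by (simp only:)
  qed
  then have "(\<Sum>d\<in>{1..<m}. wt d * wt (m - d)) = (\<Sum>d\<in>{1..<m}. (1 + U ^ m + V ^ m) + U ^ d + U ^ (m - d)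
     - V ^ d - V ^ (m - d) - U ^ m * Z ^ (m - d) - U ^ m * Z ^ d)"
    by (rule sum.cong[OF refl])
  also have "\<dots> = (of_nat m - 1) * (1 + U ^ m + V ^ m) + 2 * (\<Sum>d\<in>{1..<m}. U ^ d) - 2 * (\<Sum>d\<in>{1..<m}. V ^ d)
     - 2 * U ^ m * (\<Sum>d\<in>{1..<m}. Z ^ d)"
    using m by (simp add: sum.distrib sum_subtractf rev[of "\<lambda>d. U ^ d"] rev[of "\<lambda>d. V ^ d"]
        rev[of "\<lambda>d. Z ^ d"] flip: sum_distrib_left)
  finally have eq: "(\<Sum>d\<in>{1..<m}. wt d * wt (m - d)) = \<dots>" .
  have VUZ: "V ^ m = U ^ m * Z ^ m" unfolding V_def by (rule power_mult_distrib)
  note g = one_minus_mult_geometric_sum[OF m]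
  \<comment> \<open>Sums and powers are replaced by letters tied by their defining relations, so
    that only polynomial algebra remains.\<close>
  have "(1 - U) * (1 - V) * (1 - Z) * (k * (1 + a + b) + 2 * su - 2 * sv - 2 * a * sz) =
    (1 - U) * (1 - V) * (1 - Z) * (k * (1 + a + b))
    + 2 * (1 - V) * (1 - Z) * (U - a) - 2 * (1 - U) * (1 - Z) * (V - b)
    - 2 * (1 - U) * (1 - V) * (a * Z - b)"
    if "(1 - U) * su = U - a" "(1 - V) * sv = V - b" "(1 - Z) * sz = Z - c" "b = a * c"
    for su sv sz a b c k
    using that by algebra
  from this[OF g g g VUZ] show ?thesis unfolding eq .
qed

text \<open>\<open>T\<close> is twice the sum over transpositions in \<open>sum_transpositions_cycle_prod\<close>. The
  denominators \<open>1 - U\<close>, \<open>1 - V\<close>, \<open>1 - Z\<close> come from geometric sums over the split position; they are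
  cleared because the ring has no division.\<close>

lemma cut_and_join:
  fixes m :: "'a \<Rightarrow> nat"
  assumes fin: "finite A" and pos: "\<And>x. x \<in> A \<Longrightarrow> 1 \<le> m x"
  defines "F \<equiv> \<Prod>x\<in>A. wt (m x)" and "N \<equiv> of_nat (\<Sum>x\<in>A. m x)"
  defines "T \<equiv> (\<Sum>x\<in>A. of_nat (m x) * (\<Sum>d\<in>{1..<m x}. wt d * wt (m x - d)) * (\<Prod>w\<in>A - {x}. wt (m w))) +
    (\<Sum>x\<in>A. \<Sum>y\<in>A - {x}. of_nat (m x) * of_nat (m y) * wt (m x + m y) * (\<Prod>w\<in>A - {x} - {y}. wt (m w)))"
  shows "(1 - U) * (1 - V) * (1 - Z) * T =
    (1 - U) * (1 - V) * (1 - Z) *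
      (N * (N * F) - N * F - 2 * (N * D1 F) + 2 * D1 (D1 F) - 2 * D1 (D2 F) + 2 * D2 F)
    + 2 * (1 - V) * (1 - Z) * (U * (N * F - D1 F) - (D1 F - D2 F))
    - 2 * (1 - U) * (1 - Z) * (V * (N * F - D1 F) + D2 F)
    - 2 * (1 - U) * (1 - V) * (Z * (D1 F - D2 F) + D2 F)"
proof -
  let ?K = "(1 - U) * (1 - V) * (1 - Z)"
  define g where "g x = wt (m x)" for x
  define M :: "'a \<Rightarrow> 'r" where "M x = of_nat (m x)" for x
  define P where "P x = (\<Prod>w\<in>A - {x}. g w)" for x
  define PP where "PP x y = (\<Prod>w\<in>A - {x} - {y}. g w)" for x y
  \<comment> \<open>\<open>L\<close> collects terms that single out one cycle, \<open>B\<close>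
    those that single out an ordered pair of cycles. Every part of the identity is a combination of
    the two kinds, and each kind is compared separately.\<close>
  define L where "L f = (\<Sum>x\<in>A. f x * P x)" for f :: "'a \<Rightarrow> 'r"
  define B where "B h = (\<Sum>x\<in>A. \<Sum>y\<in>A - {x}. h x y * PP x y)" for h :: "'a \<Rightarrow> 'a \<Rightarrow> 'r"
  have L_add: "L (\<lambda>x. f x + f' x) = L f + L f'" for f f'
    by (simp add: L_def sum.distrib distrib_right)
  have L_diff: "L (\<lambda>x. f x - f' x) = L f - L f'" for f f'
    by (simp add: L_def sum_subtractf left_diff_distrib)
  have L_scale: "L (\<lambda>x. k * f x) = k * L f" for k f
    by (simp add: L_def sum_distrib_left mult.assoc)
  have B_add: "B (\<lambda>x y. h x y + h' x y) = B h + B h'" for h h'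
    by (simp add: B_def sum.distrib distrib_right)
  have B_diff: "B (\<lambda>x y. h x y - h' x y) = B h - B h'" for h h'
    by (simp add: B_def sum_subtractf left_diff_distrib)
  have B_scale: "B (\<lambda>x y. k * h x y) = k * B h" for k h
    by (simp add: B_def sum_distrib_left mult.assoc)
  have F: "F = (\<Prod>x\<in>A. g x)" by (simp add: F_def g_def)
  have FP: "F = g x * P x" if "x \<in> A" for x
    using that fin by (simp add: F P_def prod.remove)
  have PPP: "P x = g y * PP x y" if "y \<in> A - {x}" for x y
    using that fin by (simp add: P_def PP_def prod.remove)
  have N: "N = (\<Sum>x\<in>A. M x)" by (simp add: N_def M_def)
  have NF: "N * F = L (\<lambda>x. M x * g x)"
    unfolding N L_def sum_distrib_right using FP by (intro sum.cong) (auto simp: mult.assoc)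
  \<comment> \<open>\<open>N\<close> is the sum of all cycle lengths: the length of \<open>x\<close>
    itself contributes to \<open>L\<close>, the others to \<open>B\<close>.\<close>
  have NL: "N * L f = L (\<lambda>x. M x * f x) + B (\<lambda>x y. f x * (M y * g y))" for f
  proof -
    have "N * (f x * P x) = M x * f x * P x + (\<Sum>y\<in>A - {x}. f x * (M y * g y) * PP x y)"
      if "x \<in> A" for x
    proof -
      have "N = M x + (\<Sum>y\<in>A - {x}. M y)" using fin that by (simp add: N sum.remove)
      moreover have "(\<Sum>y\<in>A - {x}. M y) * (f x * P x) = (\<Sum>y\<in>A - {x}. f x * (M y * g y) * PP x y)"
        unfolding sum_distrib_right
      proof (rule sum.cong[OF refl])
        show "M y * (f x * P x) = f x * (M y * g y) * PP x y" if "y \<in> A - {x}" for y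
          using PPP[OF that] by (simp only: mult_ac)
      qed
      ultimately show ?thesis by (simp add: distrib_right mult.assoc)
    qed
    then show ?thesis
      unfolding L_def B_def sum_distrib_left sum.distrib[symmetric] by (rule sum.cong[OF refl])
  qed
  have D1F: "D1 F = L (\<lambda>x. D1 (g x))" and D2F: "D2 F = L (\<lambda>x. D2 (g x))"
    unfolding F L_def P_def using derivation_prod[OF d1 fin] derivation_prod[OF d2 fin] by auto
  have D11F: "D1 (D1 F) = L (\<lambda>x. D1 (D1 (g x))) + B (\<lambda>x y. D1 (g x) * D1 (g y))"
    unfolding F L_def P_def B_def PP_def by (rule derivation2_prod[OF d1 d1 fin])
  have D12F: "D1 (D2 F) = L (\<lambda>x. D1 (D2 (g x))) + B (\<lambda>x y. D2 (g x) * D1 (g y))"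
    unfolding F L_def P_def B_def PP_def by (rule derivation2_prod[OF d2 d1 fin])
  have NNF: "N * (N * F) = L (\<lambda>x. M x * (M x * g x)) + B (\<lambda>x y. M x * g x * (M y * g y))"
    unfolding NF by (rule NL)
  have ND1F: "N * D1 F = L (\<lambda>x. M x * D1 (g x)) + B (\<lambda>x y. D1 (g x) * (M y * g y))"
    unfolding D1F by (rule NL)
  define s where "s x = (\<Sum>d\<in>{1..<m x}. wt d * wt (m x - d))" for x
  have T: "T = L (\<lambda>x. M x * s x) + B (\<lambda>x y. M x * M y * wt (m x + m y))"
    by (simp add: T_def L_def B_def M_def s_def P_def PP_def g_def mult.assoc)
  \<comment> \<open>The join terms agree with the two-cycle terms of the operator up to a remainder
    that is antisymmetric in the two cycles, so it vanishes in the sum over ordered pairs.\<close>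
  have "B (\<lambda>x y. M x * M y * wt (m x + m y) - M x * g x * (M y * g y)
      + 2 * (D1 (g x) * (M y * g y)) - 2 * (D1 (g x) * D1 (g y)) + 2 * (D2 (g x) * D1 (g y))) = 0"
    unfolding B_def
  proof (rule sum_off_diagonal_antisym[OF fin])
    show "PP x y = PP y x" for x y
      unfolding PP_def by (metis Diff_insert insert_commute)
    show "M x * M y * wt (m x + m y) - M x * g x * (M y * g y)
        + 2 * (D1 (g x) * (M y * g y)) - 2 * (D1 (g x) * D1 (g y)) + 2 * (D2 (g x) * D1 (g y))
      + (M y * M x * wt (m y + m x) - M y * g y * (M x * g x)
        + 2 * (D1 (g y) * (M x * g x)) - 2 * (D1 (g y) * D1 (g x)) + 2 * (D2 (g y) * D1 (g x))) = 0" for x y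
    proof -
      have "k * l * (1 + a * a' - b * b') - k * (1 + a - b) * (l * (1 + a' - b'))
          + 2 * (k * (a - b) * (l * (1 + a' - b'))) - 2 * (k * (a - b) * (l * (a' - b')))
          + 2 * (- k * b * (l * (a' - b')))
        + (l * k * (1 + a' * a - b' * b) - l * (1 + a' - b') * (k * (1 + a - b))
          + 2 * (l * (a' - b') * (k * (1 + a - b))) - 2 * (l * (a' - b') * (k * (a - b)))
          + 2 * (- l * b' * (k * (a - b)))) = 0" for k l a b a' b' :: 'r
        by algebra
      then show ?thesis unfolding g_def D_wt M_def unfolding wt_def power_add .
    qed
  qed
  then have B0: "B (\<lambda>x y. M x * M y * wt (m x + m y)) = B (\<lambda>x y. M x * g x * (M y * g y))
      - 2 * B (\<lambda>x y. D1 (g x) * (M y * g y)) + 2 * B (\<lambda>x y. D1 (g x) * D1 (g y))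
      - 2 * B (\<lambda>x y. D2 (g x) * D1 (g y))"
    unfolding B_add B_diff B_scale by (simp add: algebra_simps)
  \<comment> \<open>Termwise this is \<open>split_sum_wt\<close> multiplied by the cycle
    length.\<close>
  have "L (\<lambda>x. ?K * (M x * s x)) = L (\<lambda>x. ?K * (M x * (M x * g x) - M x * g x - 2 * (M x * D1 (g x))
        + 2 * D1 (D1 (g x)) - 2 * D1 (D2 (g x)) + 2 * D2 (g x))
    + 2 * (1 - V) * (1 - Z) * (U * (M x * g x - D1 (g x)) - (D1 (g x) - D2 (g x)))
    - 2 * (1 - U) * (1 - Z) * (V * (M x * g x - D1 (g x)) + D2 (g x))
    - 2 * (1 - U) * (1 - V) * (Z * (D1 (g x) - D2 (g x)) + D2 (g x)))"
    unfolding L_def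
  proof (intro sum.cong refl arg_cong2[where f = "(*)"])
    fix x assume x: "x \<in> A"
    show "?K * (M x * s x) = ?K * (M x * (M x * g x) - M x * g x - 2 * (M x * D1 (g x))
        + 2 * D1 (D1 (g x)) - 2 * D1 (D2 (g x)) + 2 * D2 (g x))
    + 2 * (1 - V) * (1 - Z) * (U * (M x * g x - D1 (g x)) - (D1 (g x) - D2 (g x)))
    - 2 * (1 - U) * (1 - Z) * (V * (M x * g x - D1 (g x)) + D2 (g x))
    - 2 * (1 - U) * (1 - V) * (Z * (D1 (g x) - D2 (g x)) + D2 (g x))"
    proof -
      have "?K * (k * t) = ?K * (k * (k * (1 + a - b)) - k * (1 + a - b) - 2 * (k * (k * (a - b)))
          + 2 * (k * k * (a - b)) - 2 * (- k * k * b) + 2 * (- k * b))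
        + 2 * (1 - V) * (1 - Z) * (U * (k * (1 + a - b) - k * (a - b)) - (k * (a - b) - - k * b))
        - 2 * (1 - U) * (1 - Z) * (V * (k * (1 + a - b) - k * (a - b)) + - k * b)
        - 2 * (1 - U) * (1 - V) * (Z * (k * (a - b) - - k * b) + - k * b)"
        if "?K * t = ?K * ((k - 1) * (1 + a + b)) + 2 * (1 - V) * (1 - Z) * (U - a)
          - 2 * (1 - U) * (1 - Z) * (V - b) - 2 * (1 - U) * (1 - V) * (a * Z - b)"
        for k a b t
      proof -
        have "?K * (k * t) = k * (?K * t)" by (simp only: mult_ac)
        then show ?thesis unfolding that by algebra
      qed
      from this[OF split_sum_wt[OF pos[OF x]]] show ?thesis
        unfolding g_def D_D_wt unfolding D_wt M_def s_def unfolding wt_def .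
    qed
  qed
  then have L0: "?K * L (\<lambda>x. M x * s x) = ?K * (L (\<lambda>x. M x * (M x * g x)) - N * F - 2 * L (\<lambda>x. M x * D1 (g x))
        + 2 * L (\<lambda>x. D1 (D1 (g x))) - 2 * L (\<lambda>x. D1 (D2 (g x))) + 2 * D2 F)
    + 2 * (1 - V) * (1 - Z) * (U * (N * F - D1 F) - (D1 F - D2 F))
    - 2 * (1 - U) * (1 - Z) * (V * (N * F - D1 F) + D2 F)
    - 2 * (1 - U) * (1 - V) * (Z * (D1 F - D2 F) + D2 F)"
    unfolding L_add L_diff L_scale NF[symmetric] D1F[symmetric] D2F[symmetric] .
  \<comment> \<open>With \<open>B0\<close> inserted, the \<open>B\<close> terms coincide on both
    sides and only \<open>L0\<close> is left.\<close>
  have "k * (l + (b - 2 * b1 + 2 * b11 - 2 * b12)) =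
      k * ((l0 + b) - nf - 2 * (l1 + b1) + 2 * (l11 + b11) - 2 * (l12 + b12) + f2) + r - r' - r''"
    if "k * l = k * (l0 - nf - 2 * l1 + 2 * l11 - 2 * l12 + f2) + r - r' - r''"
    for k l b b1 b11 b12 l0 nf l1 l11 l12 f2 r r' r'' :: 'r
    using that by (simp add: algebra_simps)
  from this[OF L0] show ?thesis
    unfolding T B0 NNF ND1F D11F D12F .
qed

text \<open>\<open>c\<close> is known only through the relation \<open>(1 - V) * c = 1 - U\<close>;
  differentiating that relation yields its derivatives without division.\<close>

lemma D_conjugator:
  assumes c: "(1 - V) * c = 1 - U"
  shows "(1 - V) * D1 c = V * c - U" and "(1 - V) * D2 c = V * c"
  using arg_cong[OF c, of D1] arg_cong[OF c, of D2]
  by (simp_all add: derivation_diff[OF d1] derivation_diff[OF d2] derivation_mult[OF d1]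
      derivation_mult[OF d2] derivation_1[OF d1] derivation_1[OF d2] D_V D1_U D2_U)
    (simp_all add: algebra_simps)

text \<open>Here \<open>c = (1 - U) / (1 - V)\<close>; this factor cancels all terms that raise the degree in \<open>U\<close>.\<close>

lemma cut_and_join_conjugated:
  assumes c: "(1 - V) * c = 1 - U" and ne: "U \<noteq> 1" "V \<noteq> 1"
    and pde: "(1 - U) * (1 - V) * (1 - Z) * T =
    (1 - U) * (1 - V) * (1 - Z) *
      (N * (N * F) - N * F - 2 * (N * D1 F) + 2 * D1 (D1 F) - 2 * D1 (D2 F) + 2 * D2 F)
    + 2 * (1 - V) * (1 - Z) * (U * (N * F - D1 F) - (D1 F - D2 F))
    - 2 * (1 - U) * (1 - Z) * (V * (N * F - D1 F) + D2 F)
    - 2 * (1 - U) * (1 - V) * (Z * (D1 F - D2 F) + D2 F)"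
  defines "Y \<equiv> c * F"
  shows "(1 - Z) * (c * T - N * (N - 1) * Y) =
    - (2 * (1 - Z) * ((N + 1) * D1 Y - D1 (D1 Y) + D1 (D2 Y))) - 2 * Z * D1 Y"
proof -
  note der = derivation_add[OF d1] derivation_add[OF d2] derivation_diff[OF d1] derivation_diff[OF d2]
    derivation_mult[OF d1] derivation_mult[OF d2] derivation_1[OF d1] derivation_1[OF d2]
  note c1 = D_conjugator(1)[OF c] and c2 = D_conjugator(2)[OF c]
  have c11: "(1 - V) * D1 (D1 c) = V * c + 2 * (V * D1 c) - U"
    and c12: "(1 - V) * D1 (D2 c) = V * c + V * D1 c + V * D2 c"
    using arg_cong[OF c1, of D1] arg_cong[OF c2, of D1]
    by (simp_all add: der D_V D1_U D2_U) (simp_all add: algebra_simps)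
  define F1 F2 F11 F12 where "F1 = D1 F" "F2 = D2 F" "F11 = D1 (D1 F)" "F12 = D1 (D2 F)"
  define a1 a2 a11 a12 where "a1 = D1 c" "a2 = D2 c" "a11 = D1 (D1 c)" "a12 = D1 (D2 c)"
  note defs = F1_F2_F11_F12_def a1_a2_a11_a12_def
  have Y1: "D1 Y = a1 * F + c * F1" and Y11: "D1 (D1 Y) = a11 * F + 2 * (a1 * F1) + c * F11"
    and Y12: "D1 (D2 Y) = a12 * F + a2 * F1 + a1 * F2 + c * F12"
    unfolding Y_def defs der by (simp_all add: algebra_simps)
  \<comment> \<open>\<open>c\<close> has denominator \<open>w\<close>, its first derivatives need at
    most \<open>w ^ 2\<close> and its second ones at most \<open>w ^ 3\<close>. The facts
    \<open>C\<close> to \<open>A12\<close> give the cleared forms as polynomials in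
    \<open>U\<close>, \<open>V\<close>, \<open>w\<close> and \<open>r\<close>.\<close>
  define w r where "w = 1 - V" and "r = 1 - U"
  have wc: "w * c = r" and wa1: "w * a1 = V * c - U" and wa2: "w * a2 = V * c"
    and wa11: "w * a11 = V * c + 2 * (V * a1) - U" and wa12: "w * a12 = V * c + V * a1 + V * a2"
    using c c1 c2 c11 c12 by (simp_all add: w_def r_def defs)
  have C: "w ^ 2 * c = w * r"
    using wc by (simp add: power2_eq_square mult.assoc)
  have "w ^ 2 * a2 = w * (w * a2)" "w ^ 2 * a1 = w * (w * a1)" by algebra+
  moreover have "w * (V * c) = V * (w * c)" "w * (V * c - U) = V * (w * c) - U * w" by algebra+
  ultimately have A2: "w ^ 2 * a2 = V * r" and A1: "w ^ 2 * a1 = V * r - U * w"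
    unfolding wa1 wa2 wc by simp_all
  have "w ^ 3 * a11 = w ^ 2 * (w * a11)" "w ^ 3 * a12 = w ^ 2 * (w * a12)" by algebra+
  moreover have "w ^ 2 * (V * c + 2 * (V * a1) - U) = w * V * (w * c) + 2 * V * (w ^ 2 * a1) - U * w ^ 2"
    "w ^ 2 * (V * c + V * a1 + V * a2) = w * V * (w * c) + V * (w ^ 2 * a1) + V * (w ^ 2 * a2)"
    by algebra+
  ultimately have A11: "w ^ 3 * a11 = w * V * r + 2 * V * (V * r - U * w) - U * w ^ 2"
    and A12: "w ^ 3 * a12 = w * V * r + V * (V * r - U * w) + V * (V * r)"
    unfolding wa11 wa12 wc A1 A2 by simp_all
  let ?R = "r * w * (1 - Z) *
      (N * (N * F) - N * F - 2 * (N * F1) + 2 * F11 - 2 * F12 + 2 * F2)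
    + 2 * w * (1 - Z) * (U * (N * F - F1) - (F1 - F2))
    - 2 * r * (1 - Z) * (V * (N * F - F1) + F2)
    - 2 * r * w * (Z * (F1 - F2) + F2)"
  have pde': "r * w * (1 - Z) * T = ?R"
    using pde unfolding w_def r_def defs .
  \<comment> \<open>Of the multiplier, \<open>w ^ 2\<close> clears \<open>c\<close> and
    \<open>r * w\<close> is the factor required by \<open>pde'\<close>. Both sides become
    polynomials, compared after unfolding \<open>V\<close> as \<open>U * Z\<close>; the multiplier
    is cancelled at the end.\<close>
  have "r * w ^ 3 * ((1 - Z) * (c * T - N * (N - 1) * (c * F))) =
      (w ^ 2 * c) * (r * w * (1 - Z) * T) - r * w * (1 - Z) * N * (N - 1) * F * (w ^ 2 * c)"
    by algebra
  also have "\<dots> = w * r * ?R - r * w * (1 - Z) * N * (N - 1) * F * (w * r)"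
    unfolding pde' C ..
  also have "\<dots> = - (2 * (1 - Z) * r * ((N + 1) * (w * F * (V * r - U * w) + w * F1 * (w * r))
      - ((w * V * r + 2 * V * (V * r - U * w) - U * w ^ 2) * F + 2 * w * F1 * (V * r - U * w) + w * F11 * (w * r))
      + ((w * V * r + V * (V * r - U * w) + V * (V * r)) * F + w * F1 * (V * r) + w * F2 * (V * r - U * w) + w * F12 * (w * r))))
      - 2 * Z * r * (w * F * (V * r - U * w) + w * F1 * (w * r))"
    unfolding w_def r_def V_def by algebra
  also have "\<dots> = - (2 * (1 - Z) * r * ((N + 1) * (w * F * (w ^ 2 * a1) + w * F1 * (w ^ 2 * c))
      - ((w ^ 3 * a11) * F + 2 * w * F1 * (w ^ 2 * a1) + w * F11 * (w ^ 2 * c))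
      + ((w ^ 3 * a12) * F + w * F1 * (w ^ 2 * a2) + w * F2 * (w ^ 2 * a1) + w * F12 * (w ^ 2 * c))))
      - 2 * Z * r * (w * F * (w ^ 2 * a1) + w * F1 * (w ^ 2 * c))"
    unfolding A1 A2 A11 A12 C ..
  also have "\<dots> = r * w ^ 3 * (- (2 * (1 - Z) * ((N + 1) * D1 Y - D1 (D1 Y) + D1 (D2 Y))) - 2 * Z * D1 Y)"
    unfolding Y11 Y12 unfolding Y1 by algebra
  finally have "r * w ^ 3 * ((1 - Z) * (c * T - N * (N - 1) * Y)) = \<dots>" unfolding Y_def .
  moreover have "r * w ^ 3 \<noteq> 0" using ne by (simp add: r_def w_def)
  ultimately show ?thesis by (simp only: mult_cancel_left) simp
qed

end

section \<open>Eigenfunctions of the generator\<close>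

abbreviation zvar :: "real poly" where
  "zvar \<equiv> [:0, 1:]"

definition theta_u :: "real poly fps \<Rightarrow> real poly fps" where
  "theta_u f = fps_X * fps_deriv f"

definition theta_z :: "real poly fps \<Rightarrow> real poly fps" where
  "theta_z f = Abs_fps (\<lambda>k. zvar * pderiv (f $ k))"

lemma derivation_zvar_pderiv: "derivation (\<lambda>f :: real poly. zvar * pderiv f)"
  unfolding derivation_def by (auto simp: pderiv_add pderiv_mult algebra_simps)

lemma derivation_theta_z: "derivation theta_z"
  unfolding derivation_def
proof (intro conjI allI)
  note d = derivation_zvar_pderiv
  show "theta_z (f + g) = theta_z f + theta_z g" for f g
    using derivation_add[OF d] by (simp add: theta_z_def fps_eq_iff)
  show "theta_z (f * g) = theta_z f * g + f * theta_z g" for f g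
  proof (rule fps_ext)
    fix k
    show "theta_z (f * g) $ k = (theta_z f * g + f * theta_z g) $ k"
      unfolding theta_z_def fps_nth_Abs_fps fps_add_nth fps_mult_nth
        derivation_sum[OF d] derivation_mult[OF d] sum.distrib ..
  qed
qed

interpretation uz: euler_pair theta_u theta_z fps_X "fps_const zvar"
proof
  show "derivation theta_u"
    unfolding derivation_def theta_u_def by (auto simp: algebra_simps)
  show "derivation theta_z" by (rule derivation_theta_z)
  show "theta_u fps_X = fps_X" "theta_u (fps_const zvar) = 0"
    by (simp_all add: theta_u_def)
  show "theta_z fps_X = 0" by (simp add: theta_z_def fps_eq_iff fps_X_def)
  show "theta_z (fps_const zvar) = fps_const zvar"
    by (simp add: theta_z_def fps_eq_iff pderiv_pCons)
qed

text \<open>The series of 1 / (1 - u z).\<close>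

definition geo :: "real poly fps" where
  "geo = Abs_fps (\<lambda>k. zvar ^ k)"

lemma geo_inverse: "(1 - uz.V) * geo = 1"
proof (rule fps_ext)
  fix k
  have "(1 - uz.V) * geo = geo - fps_X * (fps_const zvar * geo)"
    by (simp add: uz.V_def algebra_simps)
  then show "((1 - uz.V) * geo) $ k = 1 $ k"
    by (cases k) (simp_all add: geo_def)
qed

text \<open>The factor \<open>(1 - fps_X) * geo\<close> plays the part of \<open>c\<close> in
  \<open>cut_and_join_conjugated\<close>.\<close>

definition conj_gf :: "nat \<Rightarrow> (nat \<Rightarrow> nat) \<Rightarrow> real poly fps" where
  "conj_gf n p = (1 - fps_X) * geo * cycle_prod uz.wt n p"

lemma theta_u_nth: "theta_u f $ k = of_nat k * f $ k"
  by (cases k) (simp_all add: theta_u_def)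

lemma theta_z_nth: "theta_z f $ k = zvar * pderiv (f $ k)"
  by (simp add: theta_z_def)

lemma double_card_pairs: "2 * (of_nat (card (pairs n)) :: 'b :: comm_ring_1) = of_nat n * (of_nat n - 1)"
proof -
  have "2 * (\<Sum>(i, j)\<in>pairs n. 1 :: 'b) = (\<Sum>i\<in>{1..n}. \<Sum>j\<in>{1..n} - {i}. 1)"
    by (rule double_sum_pairs) simp
  also have "\<dots> = (\<Sum>i\<in>{1..n}. of_nat n - 1)"
    by (rule sum.cong[OF refl]) (simp add: of_nat_diff)
  finally show ?thesis by (simp add: case_prod_unfold)
qed

text \<open>This is half of \<open>cut_and_join_conjugated\<close> with \<open>N = n\<close>: the
  subtracted \<open>N * (N - 1) * Y\<close> counts \<open>Y\<close> once per ordered pair and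
  completes the sum to the generator. No factor \<open>fps_X\<close> is left outside
  \<open>theta_u\<close>, so the equation separates into one for each power of u.\<close>

lemma conj_gf_generator:
  assumes p: "p permutes {1..n}"
  defines "Y \<equiv> conj_gf n p" and "Z \<equiv> fps_const zvar"
  shows "(1 - Z) * (\<Sum>(i, j)\<in>pairs n. conj_gf n (Transposition.transpose i j \<circ> p) - Y) =
    - ((1 - Z) * ((of_nat n + 1) * theta_u Y - theta_u (theta_u Y) + theta_u (theta_z Y))) - Z * theta_u Y"
proof -
  let ?O = "orbit p ` {1..n}" and ?c = "(1 - fps_X) * geo"
  define F where "F = cycle_prod uz.wt n p"
  define T where "T = (\<Sum>(i, j)\<in>pairs n. cycle_prod uz.wt n (Transposition.transpose i j \<circ> p))"
  have Y: "Y = ?c * F" by (simp add: Y_def conj_gf_def F_def)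
  have N: "(of_nat n :: real poly fps) = of_nat (\<Sum>C\<in>?O. card C)"
    using sum_card_orbits[OF p] by simp
  have F: "F = (\<Prod>C\<in>?O. uz.wt (card C))" by (simp add: F_def cycle_prod_def)
  have pos: "1 \<le> card C" if "C \<in> ?O" for C
    using that card_orbit_pos[OF p] by (auto simp: Suc_le_eq)
  have fin: "finite ?O" by simp
  have c: "(1 - uz.V) * ?c = 1 - fps_X"
    using geo_inverse by (metis mult.left_commute mult.right_neutral)
  have "fps_X \<noteq> (1 :: real poly fps)"
    by (metis fps_X_nth fps_one_nth zero_neq_one)
  moreover have "uz.V \<noteq> 1"
    using geo_inverse by auto
  ultimately have "(1 - Z) * (?c * (2 * T) - of_nat n * (of_nat n - 1) * Y) =
    - (2 * (1 - Z) * ((of_nat n + 1) * theta_u Y - theta_u (theta_u Y) + theta_u (theta_z Y))) - 2 * Z * theta_u Y"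
    using uz.cut_and_join_conjugated[OF c _ _ uz.cut_and_join[of ?O card, OF fin pos]]
    unfolding Y Z_def F N T_def sum_transpositions_cycle_prod[OF p] by blast
  moreover have "?c * (2 * T) - of_nat n * (of_nat n - 1) * Y =
    2 * (\<Sum>(i, j)\<in>pairs n. conj_gf n (Transposition.transpose i j \<circ> p) - Y)"
  proof -
    have S: "(\<Sum>(i, j)\<in>pairs n. conj_gf n (Transposition.transpose i j \<circ> p) - Y) = ?c * T - of_nat (card (pairs n)) * Y"
      by (simp add: T_def conj_gf_def sum_subtractf case_prod_unfold sum_distrib_left)
    show ?thesis
      unfolding S double_card_pairs[symmetric] by algebra
  qed
  ultimately have eq: "(1 - Z) * (2 * (\<Sum>(i, j)\<in>pairs n. conj_gf n (Transposition.transpose i j \<circ> p) - Y)) =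
    - (2 * (1 - Z) * ((of_nat n + 1) * theta_u Y - theta_u (theta_u Y) + theta_u (theta_z Y))) - 2 * Z * theta_u Y"
    by (simp only:)
  have "2 * ((1 - Z) * S) = 2 * (- ((1 - Z) * R) - Z * D)"
    if "(1 - Z) * (2 * S) = - (2 * (1 - Z) * R) - 2 * Z * D" for S R D
  proof -
    have "2 * ((1 - Z) * S) = (1 - Z) * (2 * S)" by algebra
    also note that
    also have "- (2 * (1 - Z) * R) - 2 * Z * D = 2 * (- ((1 - Z) * R) - Z * D)" by algebra
    finally show ?thesis .
  qed
  from this[OF eq] have "2 * ((1 - Z) * (\<Sum>(i, j)\<in>pairs n. conj_gf n (Transposition.transpose i j \<circ> p) - Y)) =
    2 * (- ((1 - Z) * ((of_nat n + 1) * theta_u Y - theta_u (theta_u Y) + theta_u (theta_z Y))) - Z * theta_u Y)" .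
  then show ?thesis by (simp only: mult_cancel_left) simp
qed

section \<open>Specialisation at z = 1\<close>

definition eval_z :: "real \<Rightarrow> real poly fps \<Rightarrow> real fps" where
  "eval_z a f = Abs_fps (\<lambda>k. poly (f $ k) a)"

lemma eval_z_nth: "eval_z a f $ k = poly (f $ k) a"
  by (simp add: eval_z_def)

lemma eval_z_add: "eval_z a (f + g) = eval_z a f + eval_z a g"
  and eval_z_diff: "eval_z a (f - g) = eval_z a f - eval_z a g"
  and eval_z_mult: "eval_z a (f * g) = eval_z a f * eval_z a g"
  and eval_z_1: "eval_z a 1 = 1" and eval_z_0: "eval_z a 0 = 0"
  and eval_z_X: "eval_z a fps_X = fps_X"
  by (auto simp: fps_eq_iff eval_z_nth fps_mult_nth poly_sum fps_X_def)

lemma eval_z_power: "eval_z a (f ^ m) = eval_z a f ^ m"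
  by (induction m) (simp_all add: eval_z_1 eval_z_mult)

lemma eval_z_prod: "eval_z a (\<Prod>x\<in>A. f x) = (\<Prod>x\<in>A. eval_z a (f x))"
  by (induction A rule: infinite_finite_induct) (simp_all add: eval_z_1 eval_z_mult)

lemma eval_z_sum: "eval_z a (\<Sum>x\<in>A. f x) = (\<Sum>x\<in>A. eval_z a (f x))"
  by (induction A rule: infinite_finite_induct) (simp_all add: eval_z_0 eval_z_add)

lemma eval_z_V: "eval_z 1 uz.V = fps_X"
proof -
  have "eval_z 1 (fps_const zvar) = 1" by (simp add: fps_eq_iff eval_z_nth)
  then show ?thesis by (simp add: uz.V_def eval_z_mult eval_z_X)
qed

lemma eval_z_wt: "eval_z 1 (uz.wt m) = 1"
  by (simp add: uz.wt_def eval_z_add eval_z_diff eval_z_power eval_z_V eval_z_X eval_z_1)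

lemma eval_z_geo: "(1 - fps_X) * eval_z 1 geo = 1"
  using arg_cong[OF geo_inverse, of "eval_z 1"]
  by (simp add: eval_z_mult eval_z_diff eval_z_1 eval_z_V)

text \<open>At z = 1 the terms u^m and (u z)^m of each weight cancel, and (1 - u) / (1 - u z)
  becomes 1.\<close>

lemma eval_z_conj_gf: "eval_z 1 (conj_gf n p) = 1"
  using eval_z_geo
  by (simp add: conj_gf_def cycle_prod_def eval_z_mult eval_z_diff eval_z_prod eval_z_wt eval_z_1 eval_z_X)

text \<open>The series specialises to the constant 1, so every coefficient beyond the zeroth has the
  root z = 1.\<close>

lemma conj_gf_nth_dvd:
  assumes "1 \<le> k"
  shows "1 - zvar dvd conj_gf n p $ k"
proof -
  have "poly (conj_gf n p $ k) 1 = 0"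
    using arg_cong[OF eval_z_conj_gf, of "\<lambda>f. f $ k"] assms by (simp add: eval_z_nth)
  then have "[:- 1, 1:] dvd conj_gf n p $ k" by (simp add: poly_eq_0_iff_dvd)
  then have "- [:- 1, 1:] dvd conj_gf n p $ k" by (simp only: minus_dvd_iff)
  then show ?thesis by (simp add: one_pCons)
qed

section \<open>The polynomials \<open>rho\<close> and their coefficients\<close>

text \<open>The division is exact for \<open>1 \<le> k\<close> by
  \<open>conj_gf_nth_dvd\<close>.\<close>

definition rho :: "nat \<Rightarrow> nat \<Rightarrow> (nat \<Rightarrow> nat) \<Rightarrow> real poly" where
  "rho n k p = conj_gf n p $ k div (1 - zvar)"

lemma conj_gf_nth: "1 \<le> k \<Longrightarrow> conj_gf n p $ k = (1 - zvar) * rho n k p"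
  using conj_gf_nth_dvd by (simp add: rho_def)

text \<open>On the coefficient of u^k, \<open>theta_u\<close> is multiplication by \<open>k\<close>.
  Differentiating the factor \<open>1 - zvar\<close> of that coefficient produces a term that
  cancels the stray \<open>- Z * theta_u Y\<close>; all that remains has the factor
  \<open>1 - zvar\<close> twice, which is cancelled.\<close>

lemma rho_generator:
  assumes p: "p permutes {1..n}" and k: "1 \<le> k"
  shows "(\<Sum>(i, j)\<in>pairs n. rho n k (Transposition.transpose i j \<circ> p) - rho n k p) =
    - (of_nat k * ((of_nat n + 1 - of_nat k) * rho n k p + zvar * pderiv (rho n k p)))"
proof -
  let ?w = "1 - zvar" and ?r = "rho n k p" and ?K = "of_nat k :: real poly" and ?N = "of_nat n :: real poly"
  let ?S = "\<Sum>(i, j)\<in>pairs n. rho n k (Transposition.transpose i j \<circ> p) - ?r"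
  let ?y = "conj_gf n p $ k"
  have const: "(1 - fps_const zvar) * f = f - fps_const zvar * f" "(of_nat n + 1) * f = fps_const (of_nat n) * f + f"
    for f :: "real poly fps"
    by (simp_all add: algebra_simps fps_of_nat)
  have w: "?w * f = f - zvar * f" for f by (simp add: left_diff_distrib)
  have "?w * (\<Sum>(i, j)\<in>pairs n. conj_gf n (Transposition.transpose i j \<circ> p) $ k - ?y) =
      - (?w * ((?N + 1) * (?K * ?y) - ?K * (?K * ?y) + ?K * (zvar * pderiv ?y))) - zvar * (?K * ?y)"
    using arg_cong[OF conj_gf_generator[OF p], of "\<lambda>f. f $ k"]
    unfolding const w
    by (simp add: fps_sum_nth case_prod_unfold theta_u_nth theta_z_nth fps_mult_left_const_nth distrib_right
        del: mult_pCons_left)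
  moreover have "(\<Sum>(i, j)\<in>pairs n. conj_gf n (Transposition.transpose i j \<circ> p) $ k - ?y) = ?w * ?S"
    unfolding conj_gf_nth[OF k] by (simp add: case_prod_unfold sum_distrib_left right_diff_distrib)
  moreover have "pderiv ?y = ?w * pderiv ?r - ?r"
  proof -
    have "pderiv ?w = - 1" by (simp add: one_pCons pderiv_pCons)
    then show ?thesis unfolding conj_gf_nth[OF k] pderiv_mult by simp
  qed
  ultimately have "?w * (?w * ?S) =
      - (?w * ((?N + 1) * (?K * (?w * ?r)) - ?K * (?K * (?w * ?r)) + ?K * (zvar * (?w * pderiv ?r - ?r))))
      - zvar * (?K * (?w * ?r))"
    unfolding conj_gf_nth[OF k] by simp
  also have "\<dots> = ?w * (?w * (- (?K * ((?N + 1 - ?K) * ?r + zvar * pderiv ?r))))"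
  proof -
    have "- (w * ((m + 1) * (l * (w * r)) - l * (l * (w * r)) + l * (x * (w * r' - r)))) - x * (l * (w * r))
      = w * (w * (- (l * ((m + 1 - l) * r + x * r'))))"
      if "w = 1 - x" for w l m r r' x :: "real poly"
      unfolding that by algebra
    then show ?thesis by blast
  qed
  finally have "?w * (?w * ?S) = ?w * (?w * (- (?K * ((?N + 1 - ?K) * ?r + zvar * pderiv ?r))))" .
  moreover have "?w \<noteq> 0" by (simp add: one_pCons)
  ultimately show ?thesis by (simp only: mult_cancel_left) simp
qed

lemma coeff_zvar_pderiv: "coeff (zvar * pderiv f) b = of_nat b * coeff f b"
  by (cases b) (simp_all add: coeff_pderiv)

text \<open>The operator z d/dz multiplies z^b by \<open>b\<close>, so \<open>rho_generator\<close>
  is diagonal on coefficients.\<close>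

lemma rho_coeff_eigen:
  assumes "p permutes {1..n}" and "1 \<le> k"
  shows "(\<Sum>(i, j)\<in>pairs n. coeff (rho n k (Transposition.transpose i j \<circ> p)) b - coeff (rho n k p) b) =
    - (real k * (real n + 1 - real k + real b)) * coeff (rho n k p) b"
proof -
  have c: "coeff (of_nat m * f) b = real m * coeff f b" for m and f :: "real poly"
    by (simp add: of_nat_poly)
  have "coeff ((of_nat n + 1 - of_nat k) * f) b = (real n + 1 - real k) * coeff f b" for f :: "real poly"
    by (simp add: left_diff_distrib distrib_right c)
  then show ?thesis
    using arg_cong[OF rho_generator[OF assms], of "\<lambda>f. coeff f b"]
    by (simp add: coeff_sum case_prod_unfold c coeff_zvar_pderiv algebra_simps del: mult_pCons_left)
qed

text \<open>As \<open>conj_gf n p $ k\<close> is \<open>(1 - zvar) * rho n k p\<close>, the value at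
  1 is minus the z-derivative of the former there. By the product rule the conjugating factor
  contributes 1 to that derivative and every \<open>k\<close>-cycle contributes
  \<open>- k\<close>.\<close>

lemma rho_at_1:
  assumes p: "p permutes {1..n}" and k: "1 \<le> k"
  shows "poly (rho n k p) 1 = real k * real (num_cycles n k p) - 1"
proof -
  let ?O = "orbit p ` {1..n}" and ?c = "(1 - fps_X) * geo" and ?F = "cycle_prod uz.wt n p"
  note dz = derivation_theta_z
  have evc: "eval_z 1 ?c = 1"
    using eval_z_geo by (simp add: eval_z_mult eval_z_diff eval_z_1 eval_z_X)
  have evF: "eval_z 1 ?F = 1"
    by (simp add: cycle_prod_def eval_z_prod eval_z_wt)
  have "(1 - uz.V) * ?c = 1 - fps_X"
    using geo_inverse by (metis mult.left_commute mult.right_neutral)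
  then have "(1 - uz.V) * theta_z ?c = uz.V * ?c" by (rule uz.D_conjugator)
  from arg_cong[OF this, of "eval_z 1"]
  have "(1 - fps_X) * eval_z 1 (theta_z ?c) = fps_X"
    by (simp only: eval_z_mult[of _ "1 - uz.V"] eval_z_mult[of _ uz.V] evc eval_z_diff eval_z_1 eval_z_V mult_1_right)
  \<comment> \<open>This is u / (1 - u), whose coefficients are 1 from u^1 on.\<close>
  then have evc': "eval_z 1 (theta_z ?c) = fps_X * eval_z 1 geo"
    using eval_z_geo by (metis mult.assoc mult.commute mult.right_neutral)
  have geok: "eval_z 1 geo $ i = 1" for i
    by (simp add: eval_z_nth geo_def)
  have "theta_z ?F = (\<Sum>C\<in>?O. theta_z (uz.wt (card C)) * (\<Prod>D\<in>?O - {C}. uz.wt (card D)))"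
    unfolding cycle_prod_def by (rule derivation_prod[OF dz]) simp
  \<comment> \<open>Undifferentiated weights are 1 at z = 1, so each cycle contributes on its
    own.\<close>
  also have "eval_z 1 \<dots> = (\<Sum>C\<in>?O. eval_z 1 (theta_z (uz.wt (card C))))"
    by (simp add: eval_z_sum eval_z_mult eval_z_prod eval_z_wt)
  also have "\<dots> = (\<Sum>C\<in>?O. - (of_nat (card C) * fps_X ^ card C))"
  proof (rule sum.cong[OF refl])
    fix C
    have "eval_z 1 (of_nat m) = of_nat m" for m
      by (induction m) (simp_all add: eval_z_0 eval_z_1 eval_z_add)
    moreover have "eval_z 1 (- f) = - eval_z 1 f" for f
      by (simp add: fps_eq_iff eval_z_nth)
    ultimately show "eval_z 1 (theta_z (uz.wt (card C))) = - (of_nat (card C) * fps_X ^ card C)"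
      by (simp add: uz.D_wt eval_z_mult eval_z_power eval_z_V)
  qed
  finally have "eval_z 1 (theta_z ?F) $ k = (\<Sum>C\<in>?O. - (real (card C) * (if k = card C then 1 else 0)))"
    by (simp add: fps_sum_nth fps_of_nat[symmetric] fps_mult_left_const_nth)
  also have "\<dots> = (\<Sum>C\<in>?O. if card C = k then - real k else 0)"
    by (intro sum.cong) auto
  also have "\<dots> = - (real k * real (num_cycles n k p))"
    by (simp add: num_cycles_def sum.If_cases Int_def)
  finally have evF': "eval_z 1 (theta_z ?F) $ k = \<dots>" .
  have "eval_z 1 (theta_z (conj_gf n p)) = eval_z 1 (theta_z ?c) + eval_z 1 (theta_z ?F)"
    unfolding conj_gf_def derivation_mult[OF dz, of ?c ?F]
    by (simp only: eval_z_add eval_z_mult[of _ _ ?F] eval_z_mult[of _ ?c] evc evF mult_1_left mult_1_right)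
  then have "eval_z 1 (theta_z (conj_gf n p)) $ k = 1 - real k * real (num_cycles n k p)"
    using k evF' evc' geok by simp
  moreover have "eval_z 1 (theta_z (conj_gf n p)) $ k = poly (pderiv (conj_gf n p $ k)) 1"
    by (simp add: eval_z_nth theta_z_nth)
  moreover have "poly (pderiv (conj_gf n p $ k)) 1 = - poly (rho n k p) 1"
    unfolding conj_gf_nth[OF k] by (simp add: pderiv_mult pderiv_pCons pderiv_diff)
  ultimately show ?thesis by simp
qed

text \<open>The identity has \<open>n\<close> fixed points of weight 1 + (1 - z) u each, so the
  binomial theorem gives its coefficients.\<close>

lemma rho_id:
  assumes k: "1 \<le> k"
  shows "rho n k id = of_nat (n choose k) * (1 - zvar) ^ (k - 1)
    - (\<Sum>j<k. of_nat (n choose j) * (1 - zvar) ^ j * zvar ^ (k - 1 - j))"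
proof -
  let ?w = "1 - zvar"
  have orb: "orbit id i = {i}" for i :: nat
    by (simp add: orbit_eq_singleton_iff)
  have inj: "inj_on (orbit id) {1..n}" by (rule inj_onI) (metis orb singleton_inject)
  have F: "cycle_prod uz.wt n id = (1 + fps_const ?w * fps_X) ^ n"
    unfolding cycle_prod_def prod.reindex[OF inj] comp_def orb
    by (simp add: uz.wt_def uz.V_def algebra_simps flip: fps_const_sub)
  have q: "cycle_prod uz.wt n id $ j = of_nat (n choose j) * ?w ^ j" for j
  proof -
    have "(1 + fps_const ?w * fps_X) ^ n = (\<Sum>i\<le>n. fps_const (of_nat (n choose i) * ?w ^ i) * fps_X ^ i)"
      by (subst add.commute, subst binomial_ring)
        (simp add: power_mult_distrib fps_const_power fps_of_nat[symmetric] mult.assoc flip: fps_const_mult)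
    then show ?thesis
      unfolding F by (simp add: fps_sum_nth fps_mult_left_const_nth if_distrib cong: if_cong)
  qed
  \<comment> \<open>The series without the factor 1 - u. Its k-th coefficient is a binomial term
    plus z times the previous one, so the difference of consecutive coefficients is visibly
    divisible by 1 - z; the sum in the claim is \<open>G $ (k - 1)\<close>.\<close>
  define G where "G = geo * cycle_prod uz.wt n id"
  have Gk: "G $ m = (\<Sum>j\<le>m. of_nat (n choose j) * ?w ^ j * zvar ^ (m - j))" for m
    unfolding G_def by (subst mult.commute) (simp add: fps_mult_nth q geo_def atLeast0AtMost)
  have "conj_gf n id = G - fps_X * G"
    by (simp add: conj_gf_def G_def algebra_simps)
  then have y: "conj_gf n id $ k = G $ k - G $ (k - 1)" using k by simp
  have "{..k} = insert k {..k - 1}" using k by auto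
  then have "G $ k = of_nat (n choose k) * ?w ^ k
      + (\<Sum>j\<le>k - 1. of_nat (n choose j) * ?w ^ j * zvar ^ (k - j))"
    unfolding Gk using k by (simp del: mult_pCons_left mult_pCons_right)
  also have "(\<Sum>j\<le>k - 1. of_nat (n choose j) * ?w ^ j * zvar ^ (k - j)) = zvar * G $ (k - 1)"
    unfolding Gk sum_distrib_left
  proof (rule sum.cong[OF refl])
    fix j assume "j \<in> {..k - 1}"
    then have "k - j = Suc (k - 1 - j)" using k by auto
    then show "of_nat (n choose j) * ?w ^ j * zvar ^ (k - j) = zvar * (of_nat (n choose j) * ?w ^ j * zvar ^ (k - 1 - j))"
      by (simp only: power_Suc mult_ac)
  qed
  finally have "G $ k = of_nat (n choose k) * ?w ^ k + zvar * G $ (k - 1)" .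
  moreover have "?w ^ k = ?w * ?w ^ (k - 1)" using k by (metis Suc_pred' Suc_le_eq One_nat_def power_Suc)
  moreover have "b * ((1 - x) * a) + x * g - g = (1 - x) * (b * a - g)" for a b g x :: "real poly"
    by algebra
  ultimately have "?w * rho n k id = ?w * (of_nat (n choose k) * ?w ^ (k - 1) - G $ (k - 1))"
    using y unfolding conj_gf_nth[OF k] by (simp only:)
  moreover have "?w \<noteq> 0" by (simp add: one_pCons)
  ultimately have "rho n k id = of_nat (n choose k) * ?w ^ (k - 1) - G $ (k - 1)"
    by (simp only: mult_cancel_left) simp
  moreover have "{..k - 1} = {..<k}" using k by auto
  ultimately show ?thesis by (simp only: Gk)
qed

section \<open>Expectations of eigenfunctions\<close>

lemma finite_Sn: "finite (Sn n)"
  by (rule finite_permutations) simp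

lemma id_in_Sn: "id \<in> Sn n"
  by (simp add: permutes_id)

lemma transpose_in_Sn: "(i, j) \<in> pairs n \<Longrightarrow> Transposition.transpose i j \<in> Sn n"
  by (auto intro: permutes_swap_id)

section \<open>Pairing of group algebra elements with functions\<close>

lemma ga_mult_pairing:
  "(\<Sum>s\<in>Sn n. ga_mult n a b s * F s) = (\<Sum>p\<in>Sn n. \<Sum>q\<in>Sn n. a p * b q * F (p \<circ> q))"
proof -
  let ?h = "\<lambda>(p, q). a p * b q * F (p \<circ> q)"
  have "(\<Sum>s\<in>Sn n. ga_mult n a b s * F s) =
      (\<Sum>s\<in>Sn n. \<Sum>x\<in>{x \<in> Sn n \<times> Sn n. (\<lambda>(p, q). p \<circ> q) x = s}. ?h x)"
    unfolding ga_mult_def sum_distrib_right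
    by (intro sum.cong refl) auto
  also have "\<dots> = (\<Sum>x\<in>Sn n \<times> Sn n. ?h x)"
    by (rule sum.group) (auto simp: finite_permutations intro: permutes_compose)
  finally show ?thesis by (simp add: sum.cartesian_product)
qed

lemma ga_basis_pairing: "r \<in> Sn n \<Longrightarrow> (\<Sum>p\<in>Sn n. ga_basis r p * G p) = G r"
  by (simp add: ga_basis_def if_distrib[where f = "\<lambda>x. x * _"] finite_permutations cong: if_cong)

lemma interchange_gen_pairing:
  "(\<Sum>p\<in>Sn n. interchange_gen n p * G p) = (\<Sum>(i, j)\<in>pairs n. G (Transposition.transpose i j) - G id)"
proof -
  have "(\<Sum>p\<in>Sn n. interchange_gen n p * G p) =
      (\<Sum>(i, j)\<in>pairs n. \<Sum>p\<in>Sn n. ga_basis (Transposition.transpose i j) p * G p - ga_basis id p * G p)"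
    unfolding interchange_gen_def sum_distrib_right case_prod_unfold
    by (subst sum.swap) (simp add: left_diff_distrib)
  also have "\<dots> = (\<Sum>(i, j)\<in>pairs n. G (Transposition.transpose i j) - G id)"
  proof (rule sum.cong[OF refl], clarify)
    fix i j assume "1 \<le> i" "i < j" "j \<le> n"
    then have "Transposition.transpose i j \<in> Sn n" using transpose_in_Sn by simp
    then show "(\<Sum>p\<in>Sn n. ga_basis (Transposition.transpose i j) p * G p - ga_basis id p * G p) =
        G (Transposition.transpose i j) - G id"
      by (simp only: sum_subtractf ga_basis_pairing[OF id_in_Sn] ga_basis_pairing)
  qed
  finally show ?thesis .
qed

text \<open>Given \<open>s\<close>, the left factor determines the right one, so each
  \<open>p\<close> occurs at most once and the convolution is bounded by an l1 norm times a sup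
  norm.\<close>

lemma norm_ga_mult_le:
  assumes "\<And>q. norm (b q) \<le> B"
  shows "norm (ga_mult n a b s) \<le> (\<Sum>p\<in>Sn n. norm (a p)) * B"
proof -
  let ?R = "{(p, q). p \<in> Sn n \<and> q \<in> Sn n \<and> p \<circ> q = s}"
  have B: "0 \<le> B" using assms norm_ge_zero order_trans by blast
  have inj: "inj_on fst ?R"
    by (auto simp: inj_on_def) (metis fun.inj_map_strong permutes_inj injD)
  have "norm (ga_mult n a b s) \<le> (\<Sum>x\<in>?R. norm (a (fst x)) * B)"
    unfolding ga_mult_def
    by (rule sum_norm_le) (auto simp: norm_mult intro!: mult_left_mono assms)
  also have "\<dots> = (\<Sum>p\<in>fst ` ?R. norm (a p) * B)"
    unfolding sum.reindex[OF inj] by simp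
  also have "\<dots> \<le> (\<Sum>p\<in>Sn n. norm (a p) * B)"
    by (rule sum_mono2) (use B finite_Sn in auto)
  finally show ?thesis by (simp add: sum_distrib_right)
qed

lemma norm_ga_power_le: "norm (ga_power n a m s) \<le> (\<Sum>p\<in>Sn n. norm (a p)) ^ m"
proof (induction m arbitrary: s)
  case (Suc m)
  then show ?case using norm_ga_mult_le[of "ga_power n a m"] by simp
qed (simp add: ga_basis_def)

text \<open>Comparison with the real exponential series of the l1 norm. It makes the infinite sum in
  \<open>ga_exp\<close> an actual limit.\<close>

lemma ga_exp_sums: "(\<lambda>m. ga_power n a m s / fact m) sums ga_exp n a s"
proof -
  let ?K = "\<Sum>p\<in>Sn n. norm (a p)"
  have "summable (\<lambda>m. ga_power n a m s / fact m)"
  proof (rule summable_comparison_test')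
    show "summable (\<lambda>m. ?K ^ m /\<^sub>R fact m)" by (rule summable_exp_generic)
    show "norm (ga_power n a m s / fact m) \<le> ?K ^ m /\<^sub>R fact m" for m
      using norm_ga_power_le[of n a m s] by (simp add: norm_divide divide_simps)
  qed
  then show ?thesis unfolding ga_exp_def by (rule summable_sums)
qed

text \<open>\<open>ga_power\<close> multiplies by the generator on the left, the side on which
  \<open>F\<close> is an eigenfunction, so each further power contributes a factor
  \<open>c * l\<close>.\<close>

lemma ga_exp_eigenfunction:
  fixes F :: "(nat \<Rightarrow> nat) \<Rightarrow> complex"
  assumes eig: "\<And>p. p \<in> Sn n \<Longrightarrow>
    (\<Sum>(i, j)\<in>pairs n. F (Transposition.transpose i j \<circ> p) - F p) = l * F p"
  shows "(\<Sum>p\<in>Sn n. ga_exp n (\<lambda>q. c * interchange_gen n q) p * F p) = exp (c * l) * F id"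
proof -
  let ?a = "\<lambda>q. c * interchange_gen n q"
  have pow: "(\<Sum>p\<in>Sn n. ga_power n ?a m p * F p) = (c * l) ^ m * F id" for m
  proof (induction m)
    case 0
    show ?case by (simp only: ga_power.simps ga_basis_pairing[OF id_in_Sn] power_0 mult_1_left)
  next
    case (Suc m)
    have "(\<Sum>p\<in>Sn n. ga_power n ?a (Suc m) p * F p) =
        (\<Sum>q\<in>Sn n. \<Sum>p\<in>Sn n. ?a p * ga_power n ?a m q * F (p \<circ> q))"
      unfolding ga_power.simps ga_mult_pairing by (rule sum.swap)
    also have "\<dots> = (\<Sum>q\<in>Sn n. c * ga_power n ?a m q * (\<Sum>p\<in>Sn n. interchange_gen n p * F (p \<circ> q)))"
      by (simp add: sum_distrib_left mult_ac)
    also have "\<dots> = (\<Sum>q\<in>Sn n. c * l * (ga_power n ?a m q * F q))"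
    proof (rule sum.cong[OF refl])
      fix q assume "q \<in> Sn n"
      then have "(\<Sum>p\<in>Sn n. interchange_gen n p * F (p \<circ> q)) = l * F q"
        unfolding interchange_gen_pairing id_o by (rule eig)
      then show "c * ga_power n ?a m q * (\<Sum>p\<in>Sn n. interchange_gen n p * F (p \<circ> q)) = c * l * (ga_power n ?a m q * F q)"
        by (simp only: mult_ac)
    qed
    also have "\<dots> = (c * l) ^ Suc m * F id"
      unfolding sum_distrib_left[symmetric] Suc.IH by simp
    finally show ?case .
  qed
  have "(\<lambda>m. \<Sum>p\<in>Sn n. ga_power n ?a m p / fact m * F p) sums (\<Sum>p\<in>Sn n. ga_exp n ?a p * F p)"
    by (intro sums_sum sums_mult2 ga_exp_sums)
  moreover have "(\<Sum>p\<in>Sn n. ga_power n ?a m p / fact m * F p) = (c * l) ^ m /\<^sub>R fact m * F id" for m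
    using pow[of m] by (simp add: sum_divide_distrib[symmetric] scaleR_conv_of_real field_simps)
  moreover have "(\<lambda>m. (c * l) ^ m /\<^sub>R fact m * F id) sums (exp (c * l) * F id)"
    by (intro sums_mult2 exp_converges)
  ultimately show ?thesis using sums_unique2 by force
qed

section \<open>The law of the process at a fixed time\<close>

context interchange_process
begin

lemma state_in_Sn: "0 \<le> t \<Longrightarrow> \<omega> \<in> space M \<Longrightarrow> \<sigma> t \<omega> \<in> Sn n"
  using measurable_space[OF measurable_state] by fastforce

lemma state_event:
  assumes "0 \<le> t" and "p \<in> Sn n"
  shows "{\<omega> \<in> space M. \<sigma> t \<omega> = p} \<in> events"
proof -
  have "\<sigma> t -` {p} \<inter> space M \<in> events"
    using measurable_state[OF assms(1)] by (rule measurable_sets) (use assms in simp)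
  moreover have "\<sigma> t -` {p} \<inter> space M = {\<omega> \<in> space M. \<sigma> t \<omega> = p}" by auto
  ultimately show ?thesis by simp
qed

text \<open>The increment from time 0 to \<open>t\<close> equals the state only almost surely, hence
  the comparison of two events up to a null set.\<close>

lemma prob_state:
  assumes t: "0 \<le> t" and p: "p \<in> Sn n"
  shows "complex_of_real (prob {\<omega> \<in> space M. \<sigma> t \<omega> = p}) =
    ga_exp n (\<lambda>q. complex_of_real t * interchange_gen n q) p"
proof -
  let ?A = "{\<omega> \<in> space M. \<sigma> t \<omega> \<circ> inv (\<sigma> 0 \<omega>) = p}" and ?B = "{\<omega> \<in> space M. \<sigma> t \<omega> = p}"
  \<comment> \<open>Splitting by the value \<open>b\<close> of \<open>\<sigma> 0\<close> gives a
    finite union of events about single states, so \<open>?A\<close> is measurable.\<close>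
  have "?A = (\<Union>b\<in>Sn n. {\<omega> \<in> space M. \<sigma> 0 \<omega> = b} \<inter> {\<omega> \<in> space M. \<sigma> t \<omega> = p \<circ> b})"
  proof (intro set_eqI iffI)
    fix \<omega> assume \<omega>: "\<omega> \<in> ?A"
    then have b: "\<sigma> 0 \<omega> \<in> Sn n" using state_in_Sn by simp
    have "\<sigma> t \<omega> = p \<circ> \<sigma> 0 \<omega>"
      using \<omega> permutes_inv_o(2)[of "\<sigma> 0 \<omega>" "{1..n}"] b by (auto simp: o_assoc[symmetric])
    then show "\<omega> \<in> (\<Union>b\<in>Sn n. {\<omega> \<in> space M. \<sigma> 0 \<omega> = b} \<inter> {\<omega> \<in> space M. \<sigma> t \<omega> = p \<circ> b})"
      using \<omega> b by auto
  next
    fix \<omega> assume "\<omega> \<in> (\<Union>b\<in>Sn n. {\<omega> \<in> space M. \<sigma> 0 \<omega> = b} \<inter> {\<omega> \<in> space M. \<sigma> t \<omega> = p \<circ> b})"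
    then obtain b where b: "b \<in> Sn n" "\<omega> \<in> space M" "\<sigma> 0 \<omega> = b" "\<sigma> t \<omega> = p \<circ> b" by auto
    then show "\<omega> \<in> ?A"
      using permutes_inv_o(1)[of b "{1..n}"] by (auto simp: o_assoc[symmetric])
  qed
  also have "\<dots> \<in> events"
    using state_event t p
    by (intro sets.finite_UN finite_Sn sets.Int) (auto intro: permutes_compose)
  finally have A: "?A \<in> events" .
  have "AE \<omega> in M. \<omega> \<in> ?A \<longleftrightarrow> \<omega> \<in> ?B"
    using start by eventually_elim simp
  then have "prob ?A = prob ?B"
    using A state_event[OF t p] by (rule finite_measure_eq_AE)
  then show ?thesis using increment_law[of 0 t p] t p by simp
qed

lemma expectation_state:
  fixes f :: "(nat \<Rightarrow> nat) \<Rightarrow> real"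
  assumes t: "0 \<le> t"
  shows "expectation (\<lambda>\<omega>. f (\<sigma> t \<omega>)) = (\<Sum>p\<in>Sn n. prob {\<omega> \<in> space M. \<sigma> t \<omega> = p} * f p)"
proof -
  let ?B = "\<lambda>p. {\<omega> \<in> space M. \<sigma> t \<omega> = p}"
  have "expectation (\<lambda>\<omega>. f (\<sigma> t \<omega>)) = expectation (\<lambda>\<omega>. \<Sum>p\<in>Sn n. indicator (?B p) \<omega> * f p)"
  proof (rule Bochner_Integration.integral_cong[OF refl])
    fix \<omega> assume \<omega>: "\<omega> \<in> space M"
    then have "(\<Sum>p\<in>Sn n. indicator (?B p) \<omega> * f p) = (\<Sum>p\<in>Sn n. if p = \<sigma> t \<omega> then f p else 0)"
      by (intro sum.cong refl) (auto simp: indicator_def)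
    then show "f (\<sigma> t \<omega>) = (\<Sum>p\<in>Sn n. indicator (?B p) \<omega> * f p)"
      using state_in_Sn[OF t \<omega>] finite_Sn[of n] by simp
  qed
  also have "\<dots> = (\<Sum>p\<in>Sn n. expectation (\<lambda>\<omega>. indicator (?B p) \<omega> * f p))"
    using state_event[OF t]
    by (intro Bochner_Integration.integral_sum integrable_mult_left integrable_real_indicator)
      (auto simp: less_top[symmetric])
  also have "\<dots> = (\<Sum>p\<in>Sn n. prob (?B p) * f p)"
    using state_event[OF t] by (intro sum.cong refl) simp
  finally show ?thesis .
qed

text \<open>The law is given by complex coefficients, so the eigenvalue equation is carried to the
  complex numbers and its consequence back.\<close>

lemma expectation_eigenfunction:
  fixes f :: "(nat \<Rightarrow> nat) \<Rightarrow> real"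
  assumes t: "0 \<le> t"
    and eig: "\<And>p. p \<in> Sn n \<Longrightarrow>
      (\<Sum>(i, j)\<in>pairs n. f (Transposition.transpose i j \<circ> p) - f p) = l * f p"
  shows "(\<Sum>p\<in>Sn n. prob {\<omega> \<in> space M. \<sigma> t \<omega> = p} * f p) = exp (t * l) * f id"
proof -
  have "(\<Sum>(i, j)\<in>pairs n. complex_of_real (f (Transposition.transpose i j \<circ> p)) - complex_of_real (f p))
    = complex_of_real l * complex_of_real (f p)" if "p \<in> Sn n" for p
    using arg_cong[OF eig[OF that], of complex_of_real] by (simp add: case_prod_unfold)
  note eig' = ga_exp_eigenfunction[OF this, of "complex_of_real t"]
  have e: "complex_of_real (exp (t * l)) = exp (complex_of_real t * complex_of_real l)"
    by (metis exp_of_real of_real_mult)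
  from eig'
  have "complex_of_real (\<Sum>p\<in>Sn n. prob {\<omega> \<in> space M. \<sigma> t \<omega> = p} * f p) = complex_of_real (exp (t * l) * f id)"
    by (simp add: prob_state[OF t] e id_def)
  then show ?thesis by (simp only: of_real_eq_iff)
qed

end

section \<open>The expected number of cycles\<close>

text \<open>For \<open>y\<close> in the unit interval the sum is the probability that a binomial
  variable with parameters \<open>n\<close> and \<open>1 - y\<close> is below \<open>k\<close>. Its
  derivative telescopes by \<open>(n choose k) * (n - k) = Suc k * (n choose Suc k)\<close> to one
  beta density.\<close>

lemma binomial_tail_derivative:
  assumes "k \<le> n"
  shows "((\<lambda>y::real. \<Sum>j<k. real (n choose j) * y ^ (n - j) * (1 - y) ^ j) has_real_derivative
    real k * real (n choose k) * (y ^ (n - k) * (1 - y) ^ (k - 1))) (at y)"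
  using assms
proof (induction k)
  case (Suc k)
  \<comment> \<open>For \<open>k = 0\<close> the truncated exponent \<open>k - 1\<close> is
    harmless, since its factor \<open>real k\<close> is zero.\<close>
  have "((\<lambda>y::real. real (n choose k) * y ^ (n - k) * (1 - y) ^ k) has_real_derivative
      real (n choose k) * (real (n - k) * y ^ (n - Suc k) * (1 - y) ^ k - real k * y ^ (n - k) * (1 - y) ^ (k - 1))) (at y)"
    by (auto intro!: derivative_eq_intros simp: algebra_simps)
  then have "((\<lambda>y::real. (\<Sum>j<k. real (n choose j) * y ^ (n - j) * (1 - y) ^ j) + real (n choose k) * y ^ (n - k) * (1 - y) ^ k)
      has_real_derivative real k * real (n choose k) * (y ^ (n - k) * (1 - y) ^ (k - 1)) +
      real (n choose k) * (real (n - k) * y ^ (n - Suc k) * (1 - y) ^ k - real k * y ^ (n - k) * (1 - y) ^ (k - 1))) (at y)"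
    using Suc by (intro DERIV_add) auto
  moreover have "real (n choose k) * real (n - k) = real (Suc k) * real (n choose Suc k)"
    unfolding of_nat_mult[symmetric] by (metis binomial_absorb_comp binomial_absorption mult.commute)
  then have "real k * real (n choose k) * (y ^ (n - k) * (1 - y) ^ (k - 1)) +
      real (n choose k) * (real (n - k) * y ^ (n - Suc k) * (1 - y) ^ k - real k * y ^ (n - k) * (1 - y) ^ (k - 1))
    = real (Suc k) * real (n choose Suc k) * (y ^ (n - Suc k) * (1 - y) ^ (Suc k - 1))"
    by (simp add: right_diff_distrib mult.assoc[symmetric])
  ultimately show ?case by simp
qed simp

lemma binomial_tail_integral:
  fixes x :: real
  assumes k: "1 \<le> k" "k \<le> n" and x: "x \<le> 1"
  shows "real k * real (n choose k) * integral {x..1} (\<lambda>y. y ^ (n - k) * (1 - y) ^ (k - 1)) =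
    1 - (\<Sum>j<k. real (n choose j) * x ^ (n - j) * (1 - x) ^ j)"
proof -
  let ?H = "\<lambda>y::real. \<Sum>j<k. real (n choose j) * y ^ (n - j) * (1 - y) ^ j"
  have "((\<lambda>y. real k * real (n choose k) * (y ^ (n - k) * (1 - y) ^ (k - 1))) has_integral ?H 1 - ?H x) {x..1}"
    using x by (rule fundamental_theorem_of_calculus)
      (auto intro!: has_field_derivative_at_within[OF binomial_tail_derivative[OF k(2), unfolded One_nat_def]]
        simp flip: has_real_derivative_iff_has_vector_derivative)
  \<comment> \<open>Only \<open>j = 0\<close> survives, through \<open>0 ^ 0 = 1\<close>.\<close>
  moreover have "?H 1 = 1"
    using k by (simp add: power_0_left if_distrib cong: if_cong)
  ultimately show ?thesis
    by (simp add: integral_unique flip: integral_mult_right)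
qed

theorem theorem1:
  fixes n k :: nat and t :: real
    and M :: "'a measure" and \<sigma> :: "real \<Rightarrow> 'a \<Rightarrow> nat \<Rightarrow> nat"
  assumes "1 \<le> n" and "1 \<le> k" and "k \<le> n" and "0 \<le> t"
    and "interchange_process M n \<sigma>"
  shows "prob_space.expectation M (\<lambda>\<omega>. real (num_cycles n k (\<sigma> t \<omega>))) =
    (let \<phi> = (\<lambda>y::real. y ^ (n - k) * (1 - y) ^ (k - 1)); x = exp (- t * real k)
     in real (n choose k) * (1 / real k * x * \<phi> x + integral {x..1} \<phi>))"
proof -
  interpret interchange_process M n \<sigma> by fact
  let ?x = "exp (- t * real k)"
  let ?B = "\<lambda>p. {\<omega> \<in> space M. \<sigma> t \<omega> = p}"
  let ?E = "expectation (\<lambda>\<omega>. real (num_cycles n k (\<sigma> t \<omega>)))"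
  let ?phi = "\<lambda>y::real. y ^ (n - k) * (1 - y) ^ (k - 1)"
  note nk = assms(1-4)
  \<comment> \<open>The expectation of \<open>rho n k\<close> at time \<open>t\<close>, kept as a
    polynomial in z.\<close>
  define R where "R = (\<Sum>p\<in>Sn n. smult (prob (?B p)) (rho n k p))"
  have "R = smult (?x ^ (n + 1 - k)) (pcompose (rho n k id) [:0, ?x:])"
  proof (rule poly_eqI)
    fix b
    let ?l = "- (real k * (real n + 1 - real k + real b))"
    have "coeff R b = (\<Sum>p\<in>Sn n. prob (?B p) * coeff (rho n k p) b)"
      by (simp add: R_def coeff_sum)
    also have "\<dots> = exp (t * ?l) * coeff (rho n k id) b"
    proof (rule expectation_eigenfunction[OF nk(4)])
      fix p assume "p \<in> Sn n"
      then have "p permutes {1..n}" by simp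
      then show "(\<Sum>(i, j)\<in>pairs n. coeff (rho n k (Transposition.transpose i j \<circ> p)) b - coeff (rho n k p) b)
          = ?l * coeff (rho n k p) b"
        using nk(2) by (rule rho_coeff_eigen)
    qed
    \<comment> \<open>The part of the exponent linear in \<open>b\<close> becomes the substitution
      of x z for z, the rest the prefactor.\<close>
    also have "t * ?l = real (n + 1 - k + b) * (- t * real k)"
      using nk(3) by (simp add: of_nat_diff algebra_simps)
    also have "exp \<dots> = ?x ^ (n + 1 - k) * ?x ^ b"
      by (simp only: exp_of_nat_mult power_add)
    finally show "coeff R b = coeff (smult (?x ^ (n + 1 - k)) (pcompose (rho n k id) [:0, ?x:])) b"
      by (simp add: coeff_pcompose_linear id_def)
  qed
  then have "poly R 1 = ?x ^ (n + 1 - k) * poly (rho n k id) ?x"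
    by (simp add: poly_pcompose)
  also have "poly (rho n k id) ?x = real (n choose k) * (1 - ?x) ^ (k - 1)
      - (\<Sum>j<k. real (n choose j) * (1 - ?x) ^ j * ?x ^ (k - 1 - j))"
    unfolding rho_id[OF nk(2)] by (simp add: poly_sum of_nat_poly mult.assoc)
  also have "?x ^ (n + 1 - k) * \<dots> = real (n choose k) * (?x * ?phi ?x)
      - (\<Sum>j<k. real (n choose j) * ?x ^ (n - j) * (1 - ?x) ^ j)"
  proof -
    have 1: "?x ^ (n + 1 - k) = ?x * ?x ^ (n - k)"
      using nk(3) by (simp add: Suc_diff_le)
    have 2: "?x ^ (n + 1 - k) * (\<Sum>j<k. real (n choose j) * (1 - ?x) ^ j * ?x ^ (k - 1 - j))
        = (\<Sum>j<k. real (n choose j) * ?x ^ (n - j) * (1 - ?x) ^ j)"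
      unfolding sum_distrib_left
    proof (rule sum.cong[OF refl])
      fix j assume "j \<in> {..<k}"
      then have "n - j = (n + 1 - k) + (k - 1 - j)" using nk(3) by auto
      then show "?x ^ (n + 1 - k) * (real (n choose j) * (1 - ?x) ^ j * ?x ^ (k - 1 - j))
          = real (n choose j) * ?x ^ (n - j) * (1 - ?x) ^ j"
        by (simp only: power_add mult_ac)
    qed
    show ?thesis unfolding right_diff_distrib 2 unfolding 1 by (simp only: mult_ac)
  qed
  finally have R1: "poly R 1 = \<dots>" .
  \<comment> \<open>A second evaluation at z = 1: \<open>rho_at_1\<close> brings in the cycle
    counts, and its constant is weighted by total probability 1.\<close>
  have "poly R 1 = (\<Sum>p\<in>Sn n. prob (?B p) * (real k * real (num_cycles n k p) - 1))"
    using nk(2) by (simp add: R_def poly_sum rho_at_1)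
  also have "\<dots> = real k * (\<Sum>p\<in>Sn n. prob (?B p) * real (num_cycles n k p)) - (\<Sum>p\<in>Sn n. prob (?B p) * 1)"
    by (simp add: sum_subtractf sum_distrib_left algebra_simps)
  also have "\<dots> = real k * ?E - 1"
    unfolding expectation_state[OF nk(4), symmetric] by (simp add: prob_space)
  finally have "real k * ?E = real (n choose k) * (?x * ?phi ?x)
      + (1 - (\<Sum>j<k. real (n choose j) * ?x ^ (n - j) * (1 - ?x) ^ j))"
    using R1 by simp
  \<comment> \<open>The constant from \<open>rho_at_1\<close> and the binomial sum combine to the
    integral.\<close>
  also have "\<dots> = real (n choose k) * (?x * ?phi ?x) + real k * real (n choose k) * integral {?x..1} ?phi"
    by (subst binomial_tail_integral[symmetric]) (use nk in auto)
  finally have "?E = real (n choose k) * (1 / real k * ?x * ?phi ?x + integral {?x..1} ?phi)"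
    using nk(2) by (simp add: field_simps)
  then show ?thesis by (simp only: Let_def)
qed

end
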